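(* Fix $\lambda>0$ and let $\pi$ be the Poisson distribution with mean $\lambda$. Let $\rho\in\mathscr{A}$, let $h_\rho$ be a solution on $\mathbb{Z}_+$ of $Qh_\rho=\rho-\pi(\rho)$, let $\lfloor\lambda\rfloor$ be the largest integer $\le\lambda$, and let $m_\rho=\sup_{i\geqslant 0}\frac{\Delta\rho(i)}{\Delta\rho(i+1)}$. Then $$\sup_{\|f\|_{\mathrm{Lip}(\rho)}=1}M_0(g_f)\leqslant m_\rho\,\|(-Q)^{-1}\|_{\mathrm{Lip}(\rho)},$$ $$\sup_{\|f\|_{\mathrm{Lip}(\rho)}=1}M_2(g_f)\leqslant m_\rho\,\|\Delta^2h_\rho\|_{\mathrm{Lip}(\rho)}+2\left((2\Xi_2(\lambda))\wedge\lambda^{-1}\right),$$ where $$\Xi_2(\lambda)=\begin{cases}\dfrac{(\lambda-1)^2-2e^{-\lambda}+1}{\lambda^3}, & 0<\lambda\le 1,\\[6pt] \dfrac{(e-1)(\lambda-1)^2+2\lambda+e-4}{\lambda^3e}+\displaystyle\sum_{n=1}^{\lfloor\lambda\rfloor-1}\frac{4\sqrt n\,(3(\lambda-n)^2-3(\lambda-n)+1)}{\sqrt{2\pi}\,\lambda^3(12n+1)}+\frac{4\sqrt{\lfloor\lambda\rfloor}\,(\lambda-\lfloor\lambda\rfloor)^3}{\sqrt{2\pi}\,\lambda^3(12\lfloor\lambda\rfloor+1)}, & 1<\lambda<\infty,\end{cases}$$ and $\Xi_2(\lambda)\le 1/3$ for $0<\lambda\le1$, $\Xi_2(\lambda)\le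 0.426/\sqrt\lambda$ for $1<\lambda<\infty$. If $\Delta^2\rho(i)\geqslant0$ for all $i\in\mathbb{Z}_+$, then $$\sup_{\|f\|_{\mathrm{Lip}(\rho)}=1}M_1(g_f)\leqslant m_\rho\|\Delta h_\rho\|_{\mathrm{Lip}(\rho)}+2m_\rho\,\Xi_1(\lambda),$$ and if $\Delta^2\rho(i)\leqslant 0$ for all $i\in\mathbb{Z}_+$, then $$\sup_{\|f\|_{\mathrm{Lip}(\rho)}=1}M_1(g_f)\leqslant m_\rho\|\Delta h_\rho\|_{\mathrm{Lip}(\rho)}+2\,\Xi_1(\lambda),$$ where $$\Xi_1(\lambda)=\begin{cases}\dfrac{e^{-\lambda}+\lambda-1}{\lambda^2}, & 0<\lambda\le1,\\[6pt] \dfrac{(e-1)(\lambda-1)+1}{\lambda^2e}+\dfrac{6\sqrt{\lfloor\lambda\rfloor}(\lambda-\lfloor\lambda\rfloor)^2}{\sqrt{2\pi}\,\lambda^2(12\lfloor\lambda\rfloor+1)}+\displaystyle\sum_{n=1}^{\lfloor\lambda\rfloor-1}\frac{12\sqrt n(\lambda-n)-6\sqrt n}{\sqrt{2\pi}\,\lambda^2(12n+1)}, & 1<\lambda<\infty,\end{cases}$$ and $\Xi_1(\lambda)\le 1/2$ for $0<\lambda\le1$, $\Xi_1(\lambda)\le 0.532/\sqrt\lambda$ for $1<\lambda<\infty$.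
   Context: $\pi_i=e^{-\lambda}\lambda^i/i!$, $i\in\mathbb{Z}_+=\{0,1,2,\dots\}$, and $\pi(f)=\sum_i f(i)\pi_i$. $\mathscr{A}$ is the set of strictly increasing functions $\rho$ on $\mathbb{Z}_+$ with $\sum_i|\rho(i)|\pi_i<\infty$. $\Delta g(i)=g(i+1)-g(i)$, $\Delta^kg(i)=\Delta^{k-1}g(i+1)-\Delta^{k-1}g(i)$. For a function $f$ on $\mathbb{Z}_+$, $\|f\|_{\mathrm{Lip}(\rho)}=\sup_{i\ge0}\frac{|f(i+1)-f(i)|}{\rho(i+1)-\rho(i)}$; the suprema over $f$ are over all $f:\mathbb{Z}_+\to\mathbb{R}$ with $\|f\|_{\mathrm{Lip}(\rho)}=1$. For such $f$, $g_f$ is the solution of the Stein equation $\lambda g_f(i+1)-ig_f(i)=f(i)-\pi(f)$, $i\in\mathbb{Z}_+$, i.e. $g_f(i)=\frac{1}{i\pi_i}\sum_{j=0}^{i-1}\pi_j(f(j)-\pi(f))$ for $i\ge1$, with the convention $g_f(0):=g_f(1)$. $M_k(g_f)=\sup_{i\ge1}\frac{|\Delta^kg_f(i)|}{\Delta\rho(i)}$ for $k=0,1,2$ (with $\Delta^0 g=g$). $Q$ is the generator of the birth–death process on $\mathbb{Z}_+$ with birth rate $\lambda$ and death rate $i$ at state $i$: $(Qh)(i)=\lambda(h(i+1)-h(i))+i(h(i-1)-h(i))$ (the second term absent for $i=0$). The equation $Qh=\rho-\pi(\rho)$ has a solution unique up to an additive constant, with $\Delta h_\rho(i)=\frac{1}{(i+1)\pi_{i+1}}\sum_{j=0}^i\pi_j(\rho(j)-\pi(\rho))$.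 For $f$ with $\|f\|_{\mathrm{Lip}(\rho)}<\infty$, $(-Q)^{-1}(f-\pi(f))$ denotes the unique $h$ with $\pi(h)=0$ and $-Qh=f-\pi(f)$, and $\|(-Q)^{-1}\|_{\mathrm{Lip}(\rho)}=\sup\{\|(-Q)^{-1}(f-\pi(f))\|_{\mathrm{Lip}(\rho)}:\|f\|_{\mathrm{Lip}(\rho)}=1\}$. $a\wedge b=\min(a,b)$. *)

theory Defs
  imports Complex_Main "HOL-Library.Extended_Real"
begin

definition pois :: "real \<Rightarrow> nat \<Rightarrow> real" where
  "pois lam i = exp (- lam) * lam ^ i / fact i"

definition pexp :: "real \<Rightarrow> (nat \<Rightarrow> real) \<Rightarrow> real" where
  "pexp lam f = (\<Sum>i. f i * pois lam i)"

definition classA :: "real \<Rightarrow> (nat \<Rightarrow> real) \<Rightarrow> bool" where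
  "classA lam \<rho> \<longleftrightarrow> strict_mono \<rho> \<and> summable (\<lambda>i. \<bar>\<rho> i\<bar> * pois lam i)"

fun fdiff :: "nat \<Rightarrow> (nat \<Rightarrow> real) \<Rightarrow> nat \<Rightarrow> real" where
  "fdiff 0 g i = g i"
| "fdiff (Suc k) g i = fdiff k g (Suc i) - fdiff k g i"

definition lipnorm :: "(nat \<Rightarrow> real) \<Rightarrow> (nat \<Rightarrow> real) \<Rightarrow> ereal" where
  "lipnorm \<rho> f = (SUP i. ereal (\<bar>f (Suc i) - f i\<bar> / (\<rho> (Suc i) - \<rho> i)))"

text \<open>Solution of the Stein equation, with convention g_f(0) = g_f(1)\<close>
definition gsol :: "real \<Rightarrow> (nat \<Rightarrow> real) \<Rightarrow> nat \<Rightarrow> real" where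
  "gsol lam f i = (let j = max i 1 in
     (1 / (real j * pois lam j)) * (\<Sum>k<j. pois lam k * (f k - pexp lam f)))"

definition Mk :: "(nat \<Rightarrow> real) \<Rightarrow> nat \<Rightarrow> (nat \<Rightarrow> real) \<Rightarrow> ereal" where
  "Mk \<rho> k g = (SUP i\<in>{1..}. ereal (\<bar>fdiff k g i\<bar> / fdiff 1 \<rho> i))"

text \<open>Generator of the birth-death process (birth rate lam, death rate i)\<close>
definition Qgen :: "real \<Rightarrow> (nat \<Rightarrow> real) \<Rightarrow> nat \<Rightarrow> real" where
  "Qgen lam h i = lam * (h (Suc i) - h i) + (if i = 0 then 0 else real i * (h (i - 1) - h i))"

definition Qinv :: "real \<Rightarrow> (nat \<Rightarrow> real) \<Rightarrow> nat \<Rightarrow> real" where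
  "Qinv lam f = (THE h. summable (\<lambda>i. \<bar>h i\<bar> * pois lam i) \<and> pexp lam h = 0 \<and>
                        (\<forall>i. - Qgen lam h i = f i - pexp lam f))"

definition Qinv_norm :: "real \<Rightarrow> (nat \<Rightarrow> real) \<Rightarrow> ereal" where
  "Qinv_norm lam \<rho> = (SUP f\<in>{f. lipnorm \<rho> f = 1}. lipnorm \<rho> (Qinv lam f))"

definition m_rho :: "(nat \<Rightarrow> real) \<Rightarrow> ereal" where
  "m_rho \<rho> = (SUP i. ereal (fdiff 1 \<rho> i / fdiff 1 \<rho> (Suc i)))"

definition Xi1 :: "real \<Rightarrow> real" where
  "Xi1 lam = (if lam \<le> 1 then (exp (- lam) + lam - 1) / lam ^ 2
     else ((exp 1 - 1) * (lam - 1) + 1) / (lam ^ 2 * exp 1)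
        + 6 * sqrt (real (nat \<lfloor>lam\<rfloor>)) * (lam - real (nat \<lfloor>lam\<rfloor>)) ^ 2
            / (sqrt (2 * pi) * lam ^ 2 * (12 * real (nat \<lfloor>lam\<rfloor>) + 1))
        + (\<Sum>n\<in>{1..<nat \<lfloor>lam\<rfloor>}. (12 * sqrt (real n) * (lam - real n) - 6 * sqrt (real n))
            / (sqrt (2 * pi) * lam ^ 2 * (12 * real n + 1))))"

definition Xi2 :: "real \<Rightarrow> real" where
  "Xi2 lam = (if lam \<le> 1 then ((lam - 1) ^ 2 - 2 * exp (- lam) + 1) / lam ^ 3
     else ((exp 1 - 1) * (lam - 1) ^ 2 + 2 * lam + exp 1 - 4) / (lam ^ 3 * exp 1)
        + (\<Sum>n\<in>{1..<nat \<lfloor>lam\<rfloor>}. 4 * sqrt (real n) * (3 * (lam - real n) ^ 2 - 3 * (lam - real n) + 1)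
            / (sqrt (2 * pi) * lam ^ 3 * (12 * real n + 1)))
        + 4 * sqrt (real (nat \<lfloor>lam\<rfloor>)) * (lam - real (nat \<lfloor>lam\<rfloor>)) ^ 3
            / (sqrt (2 * pi) * lam ^ 3 * (12 * real (nat \<lfloor>lam\<rfloor>) + 1)))"

end

theory Submission
  imports Defs "HOL-Analysis.Analysis"
begin

text \<open>
  Write \<open>F\<close> for the Poisson distribution function. Summation by parts gives
  \<open>g\<^sub>f(i) = - (b\<^sub>i D\<^sub>i(f) + a\<^sub>i U\<^sub>i(f))\<close>, where \<open>D\<^sub>i\<close> and \<open>U\<^sub>i\<close> only see the increments of \<open>f\<close> below
  and above \<open>i\<close>, and \<open>a\<close>, \<open>b\<close> are convex, \<open>a\<close> increasing and \<open>b\<close> decreasing. Hence the kernel of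
  \<open>\<Delta>g\<^sub>f(i)\<close> in terms of \<open>\<Delta>f\<close> changes sign once, and that of \<open>\<Delta>\<^sup>2g\<^sub>f(i)\<close> has constant sign except at
  \<open>\<Delta>f(i)\<close>. Comparing \<open>f\<close> with \<open>\<rho>\<close> bounds the two by the same expressions for \<open>\<rho>\<close>, that is by
  differences of \<open>h\<^sub>\<rho>\<close>, plus twice the mass carried by the part with the exceptional sign.

  That mass is itself a difference of a Stein solution, for \<open>f = min(\<cdot>, i)\<close> and for the indicator of
  \<open>{i+1, i+2, \<dots>}\<close>. By the M/M/\<open>\<infinity>\<close> semigroup, with \<open>s = \<lambda>(1 - e\<^sup>-\<^sup>t)\<close>, it is an integral over
  \<open>0 \<le> s \<le> \<lambda>\<close>, with weight \<open>(\<lambda> - s)\<close> or \<open>(\<lambda> - s)\<^sup>2\<close>, of point probabilities of a binomial variable plus an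
  independent Poisson(\<open>s\<close>) variable. These are at most the modal Poisson(\<open>s\<close>) probability, which is
  \<open>e\<^sup>-\<^sup>s\<close> for \<open>s \<le> 1\<close> and, by Stirling's formula with the correction \<open>1 + 1/(12n)\<close>, at most
  \<open>12 \<surd>n / (\<surd>(2\<pi>) (12n + 1))\<close> for \<open>n \<le> s \<le> n + 1\<close>. Integrating this step bound gives exactly \<open>\<Xi>\<^sub>1\<close> and \<open>\<Xi>\<^sub>2\<close>.
\<close>

section \<open>Point probabilities of the Poisson distribution\<close>

lemma pois_nonneg: "s \<ge> 0 \<Longrightarrow> pois s k \<ge> 0"
  by (simp add: pois_def)

lemma pois_pos: "s > 0 \<Longrightarrow> pois s k > 0"
  by (simp add: pois_def)

lemma pois_Suc: "real (Suc k) * pois s (Suc k) = s * pois s k"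
  by (simp add: pois_def divide_simps)

section \<open>A Stirling lower bound for factorials and the resulting bound for modal
  probabilities\<close>

definition ubar :: "nat \<Rightarrow> real" where
  "ubar n = 12 * sqrt (real n) / (sqrt (2 * pi) * (12 * real n + 1))"

text \<open>With u = 1 + x the right-hand side is (u - 1/u) / 2, whose derivative exceeds 1/u by (1
  - 1/u)^2 / 2.\<close>

lemma ln_le_symmetric:
  fixes x :: real assumes "0 \<le> x"
  shows "ln (1 + x) \<le> x * (2 + x) / (2 * (1 + x))"
proof -
  define f where "f = (\<lambda>t::real. (1 + t) / 2 - inverse (1 + t) / 2 - ln (1 + t))"
  have "f 0 \<le> f x"
  proof (rule DERIV_nonneg_imp_nondecreasing[OF assms])
    fix t :: real assume t: "0 \<le> t" "t \<le> x"
    have "(f has_real_derivative (1/2 + inverse (1 + t) ^ 2 / 2 - inverse (1 + t))) (at t)"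
      unfolding f_def using t
      by (auto intro!: derivative_eq_intros) (simp add: divide_simps, simp add: power2_eq_square algebra_simps)
    moreover have "1/2 + inverse (1 + t) ^ 2 / 2 - inverse (1 + t) = (1 - inverse (1 + t))^2 / 2"
      by (simp add: power2_eq_square algebra_simps)
    ultimately show "\<exists>y. (f has_real_derivative y) (at t) \<and> 0 \<le> y"
      by (intro exI[of _ "(1 - inverse (1 + t))^2 / 2"]) auto
  qed
  moreover have "(1 + x) / 2 - inverse (1 + x) / 2 = x * (2 + x) / (2 * (1 + x))"
    using assms by (simp add: divide_simps) (simp add: algebra_simps)
  ultimately show ?thesis by (simp add: f_def)
qed

text \<open>The left-hand side is the start of the power series of the right-hand side, whose
  omitted terms are nonnegative; the derivative of the difference is
  \<open>2 * t^6 / (1 - t^2)\<close>.\<close>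

lemma ln_ratio_ge:
  fixes y :: real assumes "0 \<le> y" "y < 1"
  shows "2 * (y + y^3/3 + y^5/5) \<le> ln ((1 + y) / (1 - y))"
proof -
  define f where "f = (\<lambda>t::real. ln (1 + t) - ln (1 - t) - 2 * (t + t^3/3 + t^5/5))"
  have "f 0 \<le> f y"
  proof (rule DERIV_nonneg_imp_nondecreasing[OF assms(1)])
    fix t :: real assume t: "0 \<le> t" "t \<le> y"
    then have t1: "t^2 < 1" using assms by (simp add: abs_square_less_1)
    have "(f has_real_derivative (1/(1+t) + 1/(1-t) - 2 * (1 + t^2 + t^4))) (at t)"
      unfolding f_def using t assms
      by (auto intro!: derivative_eq_intros)
    moreover have "1/(1+t) + 1/(1-t) - 2 * (1 + t^2 + t^4) = 2 * t^6 / (1 - t^2)"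
      using t assms t1 by (simp add: divide_simps) (simp add: power_numeral_reduce algebra_simps)
    ultimately show "\<exists>y. (f has_real_derivative y) (at t) \<and> 0 \<le> y"
      using t1 t by (intro exI[of _ "2 * t^6 / (1 - t^2)"]) auto
  qed
  then show ?thesis using assms by (simp add: f_def ln_div)
qed

text \<open>This is n! divided by \<open>sqrt n * (n/e)^n\<close>; Stirling's formula says that it
  tends to the square root of 2 pi.\<close>

definition stirling_ratio :: "nat \<Rightarrow> real" where
  "stirling_ratio n = fact n * exp n / (sqrt n * real n ^ n)"

lemma stirling_ratio_pos: "n \<ge> 1 \<Longrightarrow> stirling_ratio n > 0"
  by (simp add: stirling_ratio_def)

lemma ln_stirling_ratio_diff:
  assumes "n \<ge> 1"
  shows "ln (stirling_ratio n) - ln (stirling_ratio (Suc n)) = (n + 1/2) * ln (1 + 1 / n) - 1"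
proof -
  have *: "ln (stirling_ratio k) = ln (fact k) + k - ln k / 2 - k * ln k" if "k \<ge> 1" for k
    using that by (simp add: stirling_ratio_def ln_mult ln_div ln_sqrt ln_realpow)
  have f: "ln (fact (Suc n) :: real) = ln (1 + real n) + ln (fact n)"
    using assms by (simp add: ln_mult add_pos_pos)
  have l: "ln (1 + 1 / n) = ln (1 + real n) - ln n"
  proof -
    have "1 + 1 / real n = (1 + real n) / n" using assms by (simp add: divide_simps)
    then show ?thesis using assms by (simp add: ln_div)
  qed
  show ?thesis using assms by (simp add: * f l del: fact_Suc) (simp add: algebra_simps)
qed

text \<open>Dividing by the correction keeps the limit, and a decreasing sequence lies above its
  limit; this turns the asymptotic formula into a lower bound for every n. Monotonicity amounts to
  ln(1 + z) \<le> (n + 1/2) ln(1 + 1/n) - 1, where 1 + z is the quotient of consecutive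
  corrections.\<close>

lemma stirling_ratio_corrected_decreasing:
  assumes "n \<ge> 1"
  shows "stirling_ratio (Suc n) / (1 + 1 / (12 * real (Suc n))) \<le> stirling_ratio n / (1 + 1 / (12 * real n))"
proof -
  define x where "x = real n"
  have x: "x \<ge> 1" using assms by (simp add: x_def)
  \<comment> \<open>This y satisfies (1 + y)/(1 - y) = 1 + 1/x and (x + 1/2) * 2y = 1, so the first
    series term cancels the -1.\<close>
  define y where "y = 1 / (2 * x + 1)"
  define z where "z = 1 / (12 * x^2 + 13 * x)"
  have z: "z > 0" using x by (auto simp: z_def intro!: divide_pos_pos add_pos_pos)
  have "(1 + y) / (1 - y) = 1 + 1 / x" using x by (simp add: y_def divide_simps)
  with ln_ratio_ge[of y] x have "2 * (y + y^3/3 + y^5/5) \<le> ln (1 + 1 / x)"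
    by (simp add: y_def)
  then have "(x + 1/2) * (2 * (y + y^3/3 + y^5/5)) \<le> (x + 1/2) * ln (1 + 1 / x)"
    using x by (intro mult_left_mono) auto
  moreover have "(x + 1/2) * (2 * (y + y^3/3 + y^5/5)) = ((2*x+1)*y) * (1 + y^2/3 + y^4/5)"
    by (simp add: field_simps power_numeral_reduce)
  moreover have "(2*x+1)*y = 1" using x by (simp add: y_def)
  ultimately have A: "y^2/3 + y^4/5 \<le> (x + 1/2) * ln (1 + 1 / x) - 1" by simp
  have B: "z * (2 + z) / (2 * (1 + z)) \<le> y^2/3 + y^4/5"
  proof -
    have zz: "z * (2 + z) / (2 * (1 + z)) = (24*x^2+26*x+1) / (2 * (12*x^2+13*x) * (12*x^2+13*x+1))"
    proof -
      define w where "w = 12 * x^2 + 13 * x"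
      have "w > 0" unfolding w_def using x by (intro add_pos_pos) auto
      then have "(1/w) * (2 + 1/w) / (2 * (1 + 1/w)) = (2*w+1) / (2 * w * (w+1))"
        by (simp add: divide_simps)
      moreover have "24*x^2+26*x+1 = 2*w+1" by (simp add: w_def)
      ultimately show ?thesis unfolding z_def w_def[symmetric] by simp
    qed
    have yy: "y^2/3 + y^4/5 = (5*(2*x+1)^2 + 3) / (15 * (2*x+1)^4)"
      using x by (simp add: y_def divide_simps) (simp add: power_numeral_reduce algebra_simps)
    have "(24*x^2+26*x+1) * (15 * (2*x+1)^4) \<le> (5*(2*x+1)^2 + 3) * (2 * (12*x^2+13*x) * (12*x^2+13*x+1))"
    proof -
      \<comment> \<open>Expanded in t = x - 1, the difference of the two sides has only nonnegative
        coefficients.\<close>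
      obtain t where t: "x = 1 + t" "t \<ge> 0" using x by (metis add.commute diff_add_cancel diff_ge_0_iff_ge)
      show ?thesis unfolding t(1) using t(2)
        by (simp add: power_numeral_reduce algebra_simps)
    qed
    moreover have "a / b \<le> c / d" if "a * d \<le> c * b" "b > 0" "d > 0" for a b c d :: real
      using that by (simp add: divide_simps mult.commute)
    moreover have "0 < 2 * (12*x^2+13*x) * (12*x^2+13*x+1)" "0 < 15 * (2*x+1)^4"
      using x by (auto intro!: mult_pos_pos add_pos_pos)
    ultimately show ?thesis unfolding zz yy by blast
  qed
  have "ln (1 + z) \<le> (x + 1/2) * ln (1 + 1 / x) - 1"
    using ln_le_symmetric[of z] z A B by simp
  also have "\<dots> = ln (stirling_ratio n) - ln (stirling_ratio (Suc n))"
    using ln_stirling_ratio_diff[OF assms] by (simp add: x_def)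
  finally have "ln ((1 + z) * stirling_ratio (Suc n)) \<le> ln (stirling_ratio n)"
    using z stirling_ratio_pos[of "Suc n"] by (simp add: ln_mult)
  then have le: "(1 + z) * stirling_ratio (Suc n) \<le> stirling_ratio n"
    using z stirling_ratio_pos[of "Suc n"] stirling_ratio_pos[OF assms] by simp
  have "(1 + 1/(12*x)) = (1 + 1/(12*(x+1))) * (1 + z)"
  proof -
    have "12 * x^2 + 13 * x > 0" using x by (intro add_pos_pos) auto
    then have "1 + z = (12*x+1)*(x+1) / (12 * x^2 + 13 * x)"
      unfolding z_def by (simp add: add_divide_eq_iff) (simp add: algebra_simps power2_eq_square)
    moreover have "12 * x^2 + 13 * x = x * (12 * (x+1) + 1)" by (simp add: algebra_simps power2_eq_square)
    ultimately show ?thesis using x by (simp add: divide_simps) (simp add: algebra_simps)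
  qed
  then have "stirling_ratio (Suc n) / (1 + 1 / (12 * real (Suc n))) = 
      (1 + z) * stirling_ratio (Suc n) / (1 + 1/(12*x))"
    using z by (simp add: x_def add.commute)
  also have "\<dots> \<le> stirling_ratio n / (1 + 1 / (12 * real n))"
    unfolding x_def using le by (intro divide_right_mono) auto
  finally show ?thesis .
qed

text \<open>Keeps the limit of \<open>stirling_ratio\<close> away from 0, so that it may be
  cancelled in Wallis' identity.\<close>

lemma stirling_ratio_lower:
  assumes "n \<ge> 1" shows "exp (3/4) \<le> stirling_ratio n"
proof -
  \<comment> \<open>The extra 1/(4n) telescopes: by \<open>ln_le_symmetric\<close> each logarithmic
    decrement is at most 1/(4n) - 1/(4(n+1)), and at n = 1 there is equality.\<close>
  have "3/4 + 1 / (4 * real n) \<le> ln (stirling_ratio n)" using assms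
  proof (induction n rule: dec_induct)
    case base then show ?case by (simp add: stirling_ratio_def)
  next
    case (step n)
    then have n: "real n \<ge> 1" by simp
    have "ln (1 + 1 / n) \<le> (1/n) * (2 + 1/n) / (2 * (1 + 1/n))" by (rule ln_le_symmetric) simp
    then have "(n + 1/2) * ln (1 + 1 / n) \<le> (n + 1/2) * ((1/n) * (2 + 1/n) / (2 * (1 + 1/n)))"
      by (intro mult_left_mono) auto
    also have "\<dots> = 1 + (1 / (4 * real n) - 1 / (4 * (real n + 1)))"
    proof -
      define x where "x = real n"
      have "x \<ge> 1" using n x_def by simp
      then show ?thesis unfolding x_def[symmetric]
        by (simp add: divide_simps) (simp add: algebra_simps)
    qed
    finally show ?case using step ln_stirling_ratio_diff[of n] by (simp add: add.commute[of 1])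
  qed
  moreover have "0 \<le> 1 / (4 * real n)" by simp
  ultimately have "3/4 \<le> ln (stirling_ratio n)" by linarith
  then show ?thesis using stirling_ratio_pos[OF assms] by (metis exp_le_cancel_iff exp_ln)
qed

lemma wallis_prod_eq:
  "(\<Prod>k=1..n. (4*real k^2) / (4*real k^2 - 1)) = 2^(4*n) * fact n ^ 4 / (fact (2*n) ^ 2 * (2 * n + 1))"
proof (induction n)
  case 0 show ?case by simp
next
  case (Suc n)
  define x where "x = real n"
  define A :: real where "A = fact n" define B :: real where "B = fact (2*n)"
  have "A > 0" "B > 0" by (auto simp: A_def B_def)
  have x: "x \<ge> 0" by (simp add: x_def)
  have 1: "fact (Suc n) = (x + 1) * A" by (simp add: x_def A_def)
  have 2: "fact (2 * Suc n) = (2*x+2) * (2*x+1) * B" by (simp add: x_def B_def algebra_simps)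
  have 3: "4 * real (Suc n) ^ 2 / (4 * real (Suc n) ^ 2 - 1) = 4*(x+1)^2 / ((2*x+1)*(2*x+3))"
    by (simp add: x_def power2_eq_square algebra_simps)
  have "(\<Prod>k=1..Suc n. (4*real k^2) / (4*real k^2 - 1)) =
     2^(4*n) * A ^ 4 / (B ^ 2 * (2 * x + 1)) * (4*(x+1)^2 / ((2*x+1)*(2*x+3)))"
  proof -
    have "prod f {1..Suc n} = prod f {1..n} * f (Suc n)" for f :: "nat \<Rightarrow> real" by simp
    note this[of "\<lambda>k. (4*real k^2) / (4*real k^2 - 1)", unfolded Suc 3]
    then show ?thesis by (simp only: x_def A_def B_def of_nat_mult of_nat_numeral of_nat_add of_nat_1)
  qed
  also have "\<dots> = 2^(4*Suc n) * ((x + 1) * A) ^ 4 / (((2*x+2) * (2*x+1) * B) ^ 2 * (2 * x + 3))"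
  proof -
    have "K * a / (b * r) * (4 * q^2 / (r * s)) = 16 * K * (q^4 * a) / ((2 * q)^2 * r^2 * b * s)"
      if "q > 0" "r > 0" "s > 0" "b > 0" for K a b q r s :: real
      using that by (simp add: divide_simps power_numeral_reduce)
    from this[of "x + 1" "2*x+1" "2*x+3" "B^2" "2^(4*n)" "A^4"]
    have *: "2^(4*n) * A^4 / (B^2 * (2*x+1)) * (4 * (x+1)^2 / ((2*x+1) * (2*x+3))) =
      16 * 2^(4*n) * ((x+1)^4 * A^4) / ((2 * (x+1))^2 * (2*x+1)^2 * B^2 * (2*x+3))"
      using x \<open>B>0\<close> by simp
    have "16 * 2^(4*n) = (2::real)^(4*Suc n)" "2*x+2 = 2*(x+1)" by (simp_all add: power_add)
    then show ?thesis unfolding * by (simp only: power_mult_distrib)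
  qed
  finally show ?case unfolding 1 2 by (simp add: x_def algebra_simps)
qed

text \<open>The powers of n and e cancel between \<open>stirling_ratio n ^ 4\<close> and
  \<open>stirling_ratio (2 * n) ^ 2\<close>, leaving n!^4 / (2n)!^2, that is, the Wallis
  product.\<close>

lemma stirling_ratio_wallis:
  assumes "n \<ge> 1"
  shows "stirling_ratio n ^ 4 = stirling_ratio (2 * n) ^ 2 *
    (2 * (2 + 1 / n) * (\<Prod>k=1..n. (4*real k^2) / (4*real k^2 - 1)))"
proof -
  define A :: real where "A = fact n"
  define B :: real where "B = fact (2*n)"
  define P where "P = real n ^ n"
  define E where "E = exp (real n)"
  define T :: real where "T = 2 ^ n"
  define R where "R = sqrt (real n)"
  have pos: "A > 0" "B > 0" "P > 0" "E > 0" "R > 0" "T > 0"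
    using assms by (auto simp: A_def B_def P_def E_def R_def T_def)
  have R4: "R^4 = real n * real n" using power_mult[of R 2 2] by (simp add: R_def power2_eq_square)
  have R2: "R^2 = n" by (simp add: R_def)
  have "exp (real (2 * n)) = E^2" by (simp add: E_def exp_double)
  moreover have "real (2 * n) ^ (2 * n) = T^2 * P^2"
    by (simp add: T_def P_def power_mult_distrib power_mult[symmetric] mult.commute)
  moreover have "sqrt (real (2 * n)) = sqrt 2 * R" by (simp add: R_def real_sqrt_mult)
  ultimately have 2: "stirling_ratio (2*n) = B * E^2 / (sqrt 2 * R * (T^2 * P^2))"
    unfolding stirling_ratio_def B_def by simp
  have 1: "stirling_ratio n = A * E / (R * P)"
    by (simp add: stirling_ratio_def A_def E_def R_def P_def)
  have 3: "(2::real)^(4*n) = T^4" by (simp add: T_def power_mult[symmetric] mult.commute)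
  have "(A * E / (R * P)) ^ 4 = A^4 * E^4 / ((real n * real n) * P^4)"
    by (simp add: power_divide power_mult_distrib R4)
  moreover have "(B * E^2 / (sqrt 2 * R * (T^2 * P^2)))^2 = B^2 * E^4 / (2 * real n * (T^4 * P^4))"
    by (simp add: power_divide power_mult_distrib R2 power_mult[symmetric])
  moreover have "2 * (2 + 1 / real n) = 2 * (2 * real n + 1) / real n" using assms by (simp add: field_simps)
  moreover have "a4 * e / ((m * m) * p) = b * e / (2 * m * (t * p)) * (2 * (2 * m + 1) / m * (t * a4 / (b * (2 * m + 1))))"
    if "m > 0" "e > 0" "p > 0" "b > 0" "t > 0" for m e p b t a4 :: real
    using that by (simp add: divide_simps)
  ultimately show ?thesis unfolding 1 2 wallis_prod_eq 3 A_def[symmetric] B_def[symmetric]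
    using pos assms by simp
qed

text \<open>The limit c satisfies c^4 = c^2 * 2 pi by Wallis' product, and c > 0, hence c^2 = 2
  pi.\<close>

lemma stirling_ratio_ge:
  assumes "n \<ge> 1"
  shows "sqrt (2 * pi) * (1 + 1 / (12 * real n)) \<le> stirling_ratio n"
proof -
  define r where "r = (\<lambda>n. stirling_ratio (Suc n) / (1 + 1 / (12 * real (Suc n))))"
  have dec: "decseq r"
    unfolding r_def by (rule decseq_SucI, rule stirling_ratio_corrected_decreasing) simp
  have "\<And>i. r i \<ge> 0" unfolding r_def by (intro divide_nonneg_nonneg less_imp_le[OF stirling_ratio_pos] add_nonneg_nonneg) auto
  then obtain c where c: "r \<longlonglongrightarrow> c" "\<forall>i. c \<le> r i"
    using decseq_convergent[OF dec, of 0] by auto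
  have corr: "(\<lambda>n. 1 + 1 / (12 * real (Suc n))) \<longlonglongrightarrow> 1"
    using tendsto_add[OF tendsto_const tendsto_mult[OF tendsto_const[of "1/12"] LIMSEQ_inverse_real_of_nat], of 1]
    by (simp add: divide_simps)
  have "(\<lambda>n. stirling_ratio (Suc n)) \<longlonglongrightarrow> c"
  proof -
    have *: "(\<lambda>n. r n * (1 + 1 / (12 * real (Suc n)))) \<longlonglongrightarrow> c * 1" by (intro tendsto_mult c corr)
    have nz: "1 + 1 / (12 * real (Suc n)) \<noteq> 0" for n
      by (smt (verit) divide_nonneg_nonneg of_nat_0_le_iff)
    have "r n * (1 + 1 / (12 * real (Suc n))) = stirling_ratio (Suc n)" for n
      unfolding r_def using nz by (metis nonzero_eq_divide_eq)
    then show ?thesis using * by (simp only: mult_1_right)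
  qed
  then have lim: "stirling_ratio \<longlonglongrightarrow> c" by (rule LIMSEQ_imp_Suc)
  have cpos: "c > 0"
  proof -
    have "exp (3/4) \<le> c" by (rule LIMSEQ_le_const[OF lim]) (use stirling_ratio_lower in blast)
    then show ?thesis by (smt (verit) exp_gt_zero)
  qed
  have "(\<lambda>n. stirling_ratio (2 * n)) \<longlonglongrightarrow> c"
    by (rule LIMSEQ_subseq_LIMSEQ[OF lim, unfolded comp_def]) (simp add: strict_mono_def)
  then have "(\<lambda>n. stirling_ratio (2 * n) ^ 2 * (2 * (2 + 1 / n) * (\<Prod>k=1..n. (4*real k^2) / (4*real k^2 - 1))))
     \<longlonglongrightarrow> c^2 * (2 * (2 + 0) * (pi / 2))"
    by (intro tendsto_intros wallis lim_1_over_n)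
  moreover have "eventually (\<lambda>n. stirling_ratio (2 * n) ^ 2 * (2 * (2 + 1 / n) *
     (\<Prod>k=1..n. (4*real k^2) / (4*real k^2 - 1))) = stirling_ratio n ^ 4) sequentially"
    using eventually_ge_at_top[of 1] by eventually_elim (simp only: stirling_ratio_wallis)
  ultimately have "(\<lambda>n. stirling_ratio n ^ 4) \<longlonglongrightarrow> c^2 * (2 * (2 + 0) * (pi / 2))"
    by (rule Lim_transform_eventually)
  then have "c^4 = c^2 * (2 * (2 + 0) * (pi / 2))"
    using LIMSEQ_unique tendsto_power[OF lim] by blast
  then have "c^2 * c^2 = c^2 * (2 * pi)" by (simp add: power_numeral_reduce)
  then have "c^2 = 2 * pi" using cpos by (simp only: mult_cancel_left) simp
  then have "c = sqrt (2 * pi)" using cpos by (metis abs_of_pos real_sqrt_abs)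
  moreover have "c \<le> stirling_ratio n / (1 + 1 / (12 * real n))"
    using c(2)[THEN spec, of "n - 1"] assms by (simp add: r_def)
  ultimately show ?thesis
    by (simp add: pos_le_divide_eq add_pos_nonneg)
qed

text \<open>The diagonal probability is \<open>1 / (sqrt n * stirling_ratio n)\<close>, and
  \<open>ubar n\<close> is this expression with \<open>stirling_ratio n\<close> replaced by its
  lower bound.\<close>

lemma pois_diag_le_ubar:
  assumes "n \<ge> 1" shows "pois n n \<le> ubar n"
proof -
  have n: "real n \<ge> 1" using assms by simp
  have p: "0 < sqrt (2 * pi) * (1 + 1 / (12 * real n))" using n by (intro mult_pos_pos) (auto intro: add_pos_nonneg)
  have "pois n n = 1 / (sqrt n * stirling_ratio n)"
    using n by (simp add: pois_def stirling_ratio_def exp_minus divide_simps)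
  also have "\<dots> \<le> 1 / (sqrt n * (sqrt (2 * pi) * (1 + 1 / (12 * real n))))"
    using n stirling_ratio_ge[OF assms] stirling_ratio_pos[OF assms]
    by (intro divide_left_mono mult_left_mono mult_pos_pos[OF _ p] mult_pos_pos) auto
  also have "\<dots> = ubar n"
    using n by (simp add: ubar_def divide_simps)
  finally show ?thesis .
qed

text \<open>Consecutive probabilities have ratio s/(m+1), which is at least 1 up to index n and at
  most 1 from there on.\<close>

lemma pois_le_mode:
  assumes "real n \<le> s" "s \<le> real n + 1"
  shows "pois s k \<le> pois s n"
proof (cases "k \<le> n")
  case True
  then show ?thesis using assms(1)
  proof (induction n rule: dec_induct)
    case base show ?case by simp
  next
    case (step m)
    have s: "s > 0" using step.prems by (simp add: less_le_trans[OF of_nat_0_less_iff[THEN iffD2, of "Suc m"]])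
    have "pois s k \<le> pois s m" using step by simp
    moreover have "real (Suc m) * pois s m \<le> real (Suc m) * pois s (Suc m)"
      unfolding pois_Suc using step.prems pois_pos[OF s, of m] by (intro mult_right_mono) auto
    ultimately show ?case by (simp del: of_nat_Suc)
  qed
next
  case False
  then have "n \<le> k" by simp
  then show ?thesis
  proof (induction k rule: dec_induct)
    case base show ?case by simp
  next
    case (step m)
    have s: "s \<ge> 0" using assms by linarith
    have "real (Suc m) * pois s (Suc m) \<le> real (Suc m) * pois s m"
      unfolding pois_Suc using step.hyps assms pois_nonneg[OF s, of m] by (intro mult_right_mono) auto
    then show ?case using step.IH by (simp del: of_nat_Suc)
  qed
qed

text \<open>For fixed n the function s^n exp(-s) is largest at s = n, by (1 + (s-n)/n)^n \<le> exp(s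
  - n). Together with the mode bound this reduces everything to the diagonal value.\<close>

lemma pois_le_ubar:
  assumes "n \<ge> 1" "real n \<le> s" "s \<le> real n + 1"
  shows "pois s k \<le> ubar n"
proof -
  have n: "real n \<ge> 1" using assms(1) by simp
  have "(1 + (s - n) / n) ^ n \<le> exp (s - n)"
    using assms n by (intro exp_ge_one_plus_x_over_n_power_n) auto
  moreover have "1 + (s - n) / n = s / n" using n by (simp add: field_simps)
  ultimately have "s ^ n \<le> exp (s - n) * n ^ n"
    using n by (simp add: power_divide divide_simps)
  then have "exp (-s) * s ^ n \<le> exp (-s) * (exp (s - n) * n ^ n)" by simp
  also have "\<dots> = exp (- n) * n ^ n" by (simp add: exp_add[symmetric] mult.assoc[symmetric])
  finally have "pois s n \<le> pois n n" by (simp add: pois_def divide_right_mono)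
  then show ?thesis using pois_le_mode[OF assms(2,3)] pois_diag_le_ubar[OF assms(1)] by (meson order.trans)
qed

lemma pois_le_exp:
  assumes "0 \<le> s" "s \<le> 1"
  shows "pois s k \<le> exp (- s)"
  using pois_le_mode[of 0 s k] assms by (simp add: pois_def)

section \<open>Numerical bounds\<close>

lemma arctan_ge_taylor:
  fixes x :: real assumes "0 \<le> x"
  shows "x - x^3/3 + x^5/5 - x^7/7 \<le> arctan x"
proof -
  define f where "f = (\<lambda>t::real. arctan t - (t - t^3/3 + t^5/5 - t^7/7))"
  have "f 0 \<le> f x"
  proof (rule DERIV_nonneg_imp_nondecreasing[OF assms])
    fix t :: real
    have "(f has_real_derivative (inverse (1 + t^2) - (1 - t^2 + t^4 - t^6))) (at t)"
      unfolding f_def by (auto intro!: derivative_eq_intros)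
    moreover have "(1 + t^2) * (1 - t^2 + t^4 - t^6) = 1 - t^8"
      by (simp add: power_numeral_reduce algebra_simps)
    moreover have "t^8 \<ge> 0" by simp
    moreover have "0 < 1 + t^2" by (simp add: add_pos_nonneg)
    ultimately show "\<exists>y. (f has_real_derivative y) (at t) \<and> 0 \<le> y"
      by (intro exI[of _ "inverse (1 + t^2) - (1 - t^2 + t^4 - t^6)"])
        (simp add: inverse_eq_divide pos_le_divide_eq mult.commute[of _ "1 + t^2"])
  qed
  then show ?thesis by (simp add: f_def)
qed

lemma arctan_le_self:
  fixes x :: real assumes "0 \<le> x" shows "arctan x \<le> x"
proof -
  define f where "f = (\<lambda>t::real. t - arctan t)"
  have "f 0 \<le> f x"
  proof (rule DERIV_nonneg_imp_nondecreasing[OF assms])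
    fix t :: real
    have "(f has_real_derivative (1 - inverse (1 + t^2))) (at t)"
      unfolding f_def by (auto intro!: derivative_eq_intros)
    moreover have "inverse (1 + t^2) \<le> 1" by (simp add: inverse_le_1_iff)
    ultimately show "\<exists>y. (f has_real_derivative y) (at t) \<and> 0 \<le> y"
      by (intro exI[of _ "1 - inverse (1 + t^2)"]) simp
  qed
  then show ?thesis by (simp add: f_def)
qed

text \<open>Machin's formula. The lower bound is just sharp enough for 2 / sqrt(2 pi) \<le> 0.798;
  the upper one may be crude.\<close>

lemma pi_bounds: "31407/10000 \<le> pi" "pi \<le> 16/5"
proof -
  have m: "pi = 16 * arctan (1/5) - 4 * arctan (1/239)" using machin by simp
  show "31407/10000 \<le> pi"
    using arctan_ge_taylor[of "1/5"] arctan_le_self[of "1/239"]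
    unfolding m by (simp add: power_numeral_reduce)
  have "arctan (1/239) \<ge> 0" by simp
  then show "pi \<le> 16/5" using arctan_le_self[of "1/5"] unfolding m by linarith
qed

section \<open>The bounds for Xi_1 and Xi_2 when \<lambda> > 1\<close>

definition ubar_cum :: "nat \<Rightarrow> real" where
  "ubar_cum n = (1 - exp (-1)) + (\<Sum>k\<in>{1..<n}. ubar k)"

text \<open>The left-hand side is 12 sqrt n / (12n + 1). Expanding in 1/n shows that the correction
  constant must be at least 1/3; the value 7/20 is above this and small enough for the start n = 1,
  where 2 - 7/20 has to exceed sqrt(2 pi) (1 - 1/e).\<close>

lemma ubar_le_telescope:
  assumes "n \<ge> 1"
  shows "sqrt (2 * pi) * ubar n \<le> (2 * sqrt (Suc n) - (7/20) / sqrt (Suc n)) - (2 * sqrt n - (7/20) / sqrt n)"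
proof -
  define N where "N = real n"
  define x where "x = sqrt N" define y where "y = sqrt (N + 1)"
  have N: "N \<ge> 1" using assms by (simp add: N_def)
  have x: "x > 0" "x^2 = N" and y: "y > 0" "y^2 = N + 1" using N by (auto simp: x_def y_def)
  \<comment> \<open>The claim multiplied out by means of (y - x)(x + y) = 1; both sides are compared
    by squaring.\<close>
  have "12*N^2 + 39/5*N - 7/20 \<le> (12*N+2) * (x*y)"
  proof (rule power2_le_imp_le)
    have "(12*N+2)^2 * (N * (N + 1)) - (12*N^2 + 39/5*N - 7/20)^2
        = 24/5 * N^3 - 11/25 * N^2 + 473/50 * N - 49/400"
      by (simp add: power_numeral_reduce algebra_simps)
    moreover have "N^2 \<le> N^3" using N by (intro power_increasing) auto
    moreover have "N^2 \<ge> 0" by simp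
    ultimately have "(12*N^2 + 39/5*N - 7/20)^2 \<le> (12*N+2)^2 * (N * (N + 1))"
      using N by linarith
    also have "\<dots> = ((12*N+2) * (x*y))^2" unfolding x(2)[symmetric] y(2)[symmetric] 
      by (simp add: power_mult_distrib x y)
    finally show "(12*N^2 + 39/5*N - 7/20)^2 \<le> ((12*N+2) * (x*y))^2" .
    show "0 \<le> (12*N+2) * (x*y)" using N x y by simp
  qed
  moreover have "(x*y)^2 = N^2 + N"
    unfolding power_mult_distrib x y by (simp add: power2_eq_square algebra_simps)
  moreover have "12*x*(x+y)*(x*y) = 12 * (x^2 * (x*y)) + 12 * (x*y)^2"
    by (simp add: power2_eq_square algebra_simps)
  moreover have "(12*N+2) * (x*y) = 12 * (N * (x*y)) + 2 * (x*y)"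
    "(12*N+1) * (2*(x*y) + 7/20) = 24 * (N * (x*y)) + 2 * (x*y) + 21/5 * N + 7/20"
    by (simp_all add: algebra_simps)
  ultimately have main: "12*x*(x+y)*(x*y) \<le> (12*N+1) * (2*(x*y) + 7/20)"
    unfolding x(2) by linarith
  have yx: "(y - x) * (x + y) = 1" using x y by (simp add: power2_eq_square algebra_simps)
  have "12*x = 12*x*(x+y)*(x*y) * ((y - x) / (x*y))"
  proof -
    have "12*x*(x+y)*(x*y) * ((y - x) / (x*y)) = 12*x*((y - x) * (x + y))" using x y by simp
    then show ?thesis unfolding yx by simp
  qed
  also have "\<dots> \<le> (12*N+1) * (2*(x*y) + 7/20) * ((y - x) / (x*y))"
  proof (rule mult_right_mono[OF main])
    have "x \<le> y" by (simp add: x_def y_def)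
    then show "0 \<le> (y - x) / (x*y)" using x y by simp
  qed
  also have "\<dots> = (12*N+1) * ((2 * y - (7/20)/y) - (2*x - (7/20)/x))"
    using x y by (simp add: field_simps)
  finally have "12*x / (12*N+1) \<le> (2 * y - (7/20)/y) - (2*x - (7/20)/x)"
    using N by (simp add: divide_le_eq mult.commute)
  moreover have "sqrt (2 * pi) * ubar n = 12*x / (12*N+1)" by (simp add: ubar_def x_def N_def)
  ultimately show ?thesis by (simp add: x_def y_def N_def add.commute)
qed

text \<open>The asymptotic constant of \<^term>\<open>ubar_cum n\<close> leaves no room for a direct induction; the correction
  \<open>- 0.35 / \<surd>n\<close> makes the right-hand side telescope.\<close>

lemma ubar_cum_le_strong:
  assumes "n \<ge> 1"
  shows "sqrt (2 * pi) * ubar_cum n \<le> 2 * sqrt n - (7/20) / sqrt n"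
  using assms
proof (induction n rule: dec_induct)
  case base
  have "exp 1 * exp (-1) = (1::real)" by (simp add: exp_add[symmetric])
  moreover have "exp 1 * exp (-1) \<le> 68/25 * exp (-1::real)"
    using e_less_272 by (intro mult_right_mono) auto
  ultimately have e: "1 - exp (-1) \<le> (16/25::real)" by simp
  have "sqrt (2 * pi) \<le> sqrt ((127/50)^2)" by (rule real_sqrt_le_mono) (use pi_bounds in \<open>simp add: power2_eq_square\<close>)
  then have "sqrt (2 * pi) \<le> 127/50" by simp
  then have "sqrt (2 * pi) * (1 - exp (-1)) \<le> (127/50) * (16/25)" using e by (intro mult_mono) auto
  then show ?case by (simp add: ubar_cum_def)
next
  case (step n)
  have "ubar_cum (Suc n) = ubar_cum n + ubar n" using step by (simp add: ubar_cum_def)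
  then show ?case using step.IH ubar_le_telescope[of n] step.hyps by (simp add: distrib_left)
qed

lemma ubar_cum_le:
  assumes "n \<ge> 1" shows "ubar_cum n \<le> (399/500) * sqrt n"
proof -
  \<comment> \<open>The product 0.798 * 2.50627 is just above 2, the leading coefficient in
    \<open>ubar_cum_le_strong\<close>.\<close>
  have s: "sqrt ((250627/100000)^2) \<le> sqrt (2 * pi)" by (rule real_sqrt_le_mono) (use pi_bounds in \<open>simp add: power2_eq_square\<close>)
  have "sqrt (2 * pi) * ubar_cum n \<le> 2 * sqrt n - (7/20) / sqrt n" by (rule ubar_cum_le_strong[OF assms])
  also have "\<dots> \<le> ((250627/100000) * (399/500)) * sqrt n"
  proof -
    have "2 * sqrt n \<le> ((250627/100000) * (399/500)) * sqrt n" by (rule mult_right_mono) auto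
    moreover have "(7/20) / sqrt n \<ge> 0" by simp
    ultimately show ?thesis by linarith
  qed
  also have "\<dots> \<le> (sqrt (2 * pi) * 399/500) * sqrt n" using s by (intro mult_right_mono) auto
  finally show ?thesis by (simp add: mult.assoc)
qed

text \<open>The left-hand side is the integral over [0, x] of the step bound that is exp(-s) up to 1
  and \<open>ubar k\<close> on [k, k+1]. It interpolates \<open>ubar_cum\<close> linearly between n
  and n + 1, so concavity of the square root carries the bound over from the integers.\<close>

lemma ubar_cum_linear_le:
  assumes "n \<ge> 1" "real n \<le> x" "x \<le> real n + 1"
  shows "ubar_cum n + ubar n * (x - n) \<le> (399/500) * sqrt x"
proof -
  define t where "t = x - n"
  have t: "0 \<le> t" "t \<le> 1" using assms by (auto simp: t_def)
  define a where "a = sqrt n" define b where "b = sqrt (Suc n)"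
  have ab: "a^2 = n" "b^2 = real n + 1" by (auto simp: a_def b_def)
  have "(1 - t) * a^2 + t * b^2 - ((1 - t) * a + t * b)^2 = t * (1 - t) * (a - b)^2"
    by (simp add: power2_eq_square algebra_simps)
  moreover have "\<dots> \<ge> 0" using t by simp
  moreover have "(1 - t) * a^2 + t * b^2 = x" unfolding ab by (simp add: t_def algebra_simps)
  ultimately have conc: "(1 - t) * a + t * b \<le> sqrt x" by (intro real_le_rsqrt) simp
  have "ubar_cum (Suc n) = ubar_cum n + ubar n" using assms by (simp add: ubar_cum_def)
  then have "ubar_cum n + ubar n * t = (1 - t) * ubar_cum n + t * ubar_cum (Suc n)" by (simp add: algebra_simps)
  also have "\<dots> \<le> (1 - t) * ((399/500) * a) + t * ((399/500) * b)"
    unfolding a_def b_def using t assms by (intro add_mono mult_left_mono ubar_cum_le) auto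
  also have "\<dots> = (399/500) * ((1 - t) * a + t * b)" by (simp only: distrib_left mult.left_commute)
  also have "\<dots> \<le> (399/500) * sqrt x" using conc by simp
  finally show ?thesis by (simp add: t_def)
qed

text \<open>The numerator \<lambda>^2 Xi_1 on the piece with floor n; keeping n apart from x makes
  each piece a polynomial that can be differentiated.\<close>

definition xi_num1 :: "nat \<Rightarrow> real \<Rightarrow> real" where
  "xi_num1 n x = ((exp 1 - 1) * (x - 1) + 1) / exp 1 + ubar n * (x - n)^2 / 2
     + (\<Sum>k\<in>{1..<n}. ubar k * (x - k - 1/2))"

definition xi_num2 :: "nat \<Rightarrow> real \<Rightarrow> real" where
  "xi_num2 n x = ((exp 1 - 1) * (x - 1)^2 + 2 * x + exp 1 - 4) / exp 1 
     + (\<Sum>k\<in>{1..<n}. ubar k * (3 * (x - k)^2 - 3 * (x - k) + 1) / 3) + ubar n * (x - n)^3 / 3"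

lemma Xi1_eq:
  assumes "lam > 1" shows "Xi1 lam = xi_num1 (nat \<lfloor>lam\<rfloor>) lam / lam^2"
proof -
  have "(12 * s * y - 6 * s) / (c * L * d) = 12 * s / (c * d) * (y - 1/2) / L"
    "6 * s * z / (c * L * d) = 12 * s / (c * d) * z / 2 / L"
    for s y z c d L :: real by (simp_all add: diff_divide_distrib algebra_simps)
  moreover have "(lam \<le> 1) = False" using assms by simp
  ultimately show ?thesis
    unfolding Xi1_def xi_num1_def ubar_def
    by (simp only: if_False add_divide_distrib sum_divide_distrib divide_divide_eq_left mult.commute[of "exp 1"])
qed

lemma Xi2_eq:
  assumes "lam > 1" shows "Xi2 lam = xi_num2 (nat \<lfloor>lam\<rfloor>) lam / lam^3"
proof -
  have "4 * s * z / (c * L * d) = 12 * s / (c * d) * z / 3 / L"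
    for s z c d L :: real by (simp add: algebra_simps)
  moreover have "(lam \<le> 1) = False" using assms by simp
  ultimately show ?thesis
    unfolding Xi2_def xi_num2_def ubar_def
    by (simp only: if_False add_divide_distrib sum_divide_distrib divide_divide_eq_left mult.commute[of "exp 1"])
qed

lemma xi_num1_deriv: "(xi_num1 n has_real_derivative (ubar_cum n + ubar n * (x - n))) (at x)"
  unfolding xi_num1_def[abs_def] ubar_cum_def
  by (auto intro!: derivative_eq_intros simp: exp_minus divide_simps)

lemma xi_num2_deriv: "(xi_num2 n has_real_derivative (2 * xi_num1 n x)) (at x)"
proof -
  have "(xi_num2 n has_real_derivative (((exp 1 - 1) * (2 * (x - 1)) + 2) / exp 1
     + (\<Sum>k\<in>{1..<n}. ubar k * (3 * (2 * (x - k)) - 3) / 3) + ubar n * (3 * (x - n)^2) / 3)) (at x)"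
    unfolding xi_num2_def[abs_def] by (auto intro!: derivative_eq_intros)
  moreover have "(\<Sum>k\<in>{1..<n}. ubar k * (3 * (2 * (x - k)) - 3) / 3) = 2 * (\<Sum>k\<in>{1..<n}. ubar k * (x - k - 1/2))"
    unfolding sum_distrib_left by (intro sum.cong refl) (simp add: field_simps)
  moreover have "((exp 1 - 1) * (2 * (x - 1)) + 2) / exp 1 = 2 * (((exp 1 - 1) * (x - 1) + 1) / exp 1)"
    by (simp add: field_simps)
  ultimately have "(xi_num2 n has_real_derivative (2 * (((exp 1 - 1) * (x - 1) + 1) / exp 1)
     + 2 * (\<Sum>k\<in>{1..<n}. ubar k * (x - k - 1/2)) + ubar n * (3 * (x - n)^2) / 3)) (at x)" by metis
  then show ?thesis by (rule DERIV_cong) (simp add: xi_num1_def)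
qed

text \<open>Comparison by derivatives on each [n, n + 1]; \<open>glue\<close> is continuity at the
  integers, which lets the inequality pass from one interval to the next.\<close>

lemma piecewise_deriv_le:
  fixes f f' :: "nat \<Rightarrow> real \<Rightarrow> real" and g g' :: "real \<Rightarrow> real"
  assumes base: "f 1 1 \<le> g 1"
    and glue: "\<And>n. n \<ge> 1 \<Longrightarrow> f (Suc n) (Suc n) = f n (Suc n)"
    and df: "\<And>n x. (f n has_real_derivative f' n x) (at x)"
    and dg: "\<And>x. x \<ge> 1 \<Longrightarrow> (g has_real_derivative g' x) (at x)"
    and le: "\<And>n x. n \<ge> 1 \<Longrightarrow> real n \<le> x \<Longrightarrow> x \<le> real n + 1 \<Longrightarrow> f' n x \<le> g' x"
    and "n \<ge> 1" "real n \<le> x" "x \<le> real n + 1"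
  shows "f n x \<le> g x"
proof -
  have step: "f n x \<le> g x" if n: "n \<ge> 1" "f n n \<le> g n" "real n \<le> x" "x \<le> real n + 1" for n x
  proof -
    have "(\<lambda>t. g t - f n t) n \<le> (\<lambda>t. g t - f n t) x"
    proof (rule DERIV_nonneg_imp_nondecreasing[OF n(3)])
      fix t assume t: "real n \<le> t" "t \<le> x"
      have "((\<lambda>t. g t - f n t) has_real_derivative (g' t - f' n t)) (at t)"
        using t n by (intro DERIV_diff dg df) auto
      then show "\<exists>y. ((\<lambda>t. g t - f n t) has_real_derivative y) (at t) \<and> 0 \<le> y"
        using le[OF n(1) t(1)] t n by (intro exI[of _ "g' t - f' n t"]) auto
    qed
    then show ?thesis using n by simp
  qed
  have "f n n \<le> g n" using \<open>n \<ge> 1\<close>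
  proof (induction n rule: dec_induct)
    case base then show ?case using assms(1) by simp
  next
    case (step n)
    then show ?case using glue[of n] step(3) \<open>\<And>x n. _ \<Longrightarrow> _ \<Longrightarrow> _ \<Longrightarrow> _ \<Longrightarrow> f n x \<le> g x\<close>[of n "real (Suc n)"] by simp
  qed
  then show ?thesis using step assms by blast
qed

lemma exp1_bounds: "5/2 \<le> exp (1::real)" "exp (1::real) \<le> 68/25"
proof -
  have "abs (exp (1::real) - 5837465777 / 2147483648) \<le> inverse (2^32)" by (rule e_approx_32)
  then show "5/2 \<le> exp (1::real)" by (simp add: abs_if split: if_split_asm)
  show "exp (1::real) \<le> 68/25" using e_less_272 by simp
qed

text \<open>The derivative of 0.532 x^(3/2) is 0.798 sqrt x, so \<open>ubar_cum_linear_le\<close> is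
  exactly the required inequality of derivatives; at x = 1 the left side is 1/e.\<close>

lemma xi_num1_le:
  assumes "n \<ge> 1" "real n \<le> x" "x \<le> real n + 1"
  shows "xi_num1 n x \<le> 133/250 * (x * sqrt x)"
proof (rule piecewise_deriv_le[where f = xi_num1 and f' = "\<lambda>n x. ubar_cum n + ubar n * (x - n)"
      and g' = "\<lambda>x. (399/500) * sqrt x", OF _ _ xi_num1_deriv _ ubar_cum_linear_le assms])
  show "xi_num1 1 1 \<le> 133/250 * (1 * sqrt 1)" using exp1_bounds by (simp add: xi_num1_def divide_simps)
  show "xi_num1 (Suc n) (Suc n) = xi_num1 n (Suc n)" if "n \<ge> 1" for n
    using that by (simp add: xi_num1_def)
  show "((\<lambda>x. 133/250 * (x * sqrt x)) has_real_derivative (399/500) * sqrt x) (at x)" if "x \<ge> 1" for x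
    using that by (auto intro!: derivative_eq_intros simp: field_simps)
qed auto

text \<open>The same argument one order higher: 0.426 x^(5/2) has derivative 1.065 x^(3/2), and
  twice 0.532 is 1.064.\<close>

lemma xi_num2_le:
  assumes "n \<ge> 1" "real n \<le> x" "x \<le> real n + 1"
  shows "xi_num2 n x \<le> 213/500 * (x^2 * sqrt x)"
proof (rule piecewise_deriv_le[where f = xi_num2 and f' = "\<lambda>n x. 2 * xi_num1 n x"
      and g' = "\<lambda>x. 213/200 * (x * sqrt x)", OF _ _ xi_num2_deriv _ _ assms])
  show "xi_num2 1 1 \<le> 213/500 * (1^2 * sqrt 1)" using exp1_bounds by (simp add: xi_num2_def divide_simps)
  show "xi_num2 (Suc n) (Suc n) = xi_num2 n (Suc n)" if "n \<ge> 1" for n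
    using that by (simp add: xi_num2_def)
  show "((\<lambda>x. 213/500 * (x^2 * sqrt x)) has_real_derivative 213/200 * (x * sqrt x)) (at x)" if "x \<ge> 1" for x
    using that by (auto intro!: derivative_eq_intros simp: field_simps power2_eq_square)
  show "2 * xi_num1 n x \<le> 213/200 * (x * sqrt x)" if "n \<ge> 1" "real n \<le> x" "x \<le> real n + 1" for n x
  proof -
    have "x * sqrt x \<ge> 0" using that by simp
    then show ?thesis using xi_num1_le[OF that] by linarith
  qed
qed

lemma floor_bounds:
  assumes "lam > 1"
  shows "nat \<lfloor>lam\<rfloor> \<ge> 1" "real (nat \<lfloor>lam\<rfloor>) \<le> lam" "lam \<le> real (nat \<lfloor>lam\<rfloor>) + 1"
proof -
  have "\<lfloor>lam\<rfloor> \<ge> 1" using assms by simp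
  then show "nat \<lfloor>lam\<rfloor> \<ge> 1" "real (nat \<lfloor>lam\<rfloor>) \<le> lam" "lam \<le> real (nat \<lfloor>lam\<rfloor>) + 1"
    by (auto simp: of_nat_nat) linarith+
qed

lemma Xi1_le_large:
  assumes "lam > 1" shows "Xi1 lam \<le> 0.532 / sqrt lam"
proof -
  have "Xi1 lam \<le> 133/250 * (lam * sqrt lam) / lam^2"
    unfolding Xi1_eq[OF assms] by (intro divide_right_mono xi_num1_le floor_bounds assms) auto
  also have "\<dots> = 133/250 * (sqrt lam / lam)" using assms by (simp add: power2_eq_square)
  also have "sqrt lam / lam = 1 / sqrt lam" using assms by (simp add: sqrt_divide_self_eq inverse_eq_divide)
  finally show ?thesis by simp
qed

lemma Xi2_le_large:
  assumes "lam > 1" shows "Xi2 lam \<le> 0.426 / sqrt lam"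
proof -
  have "Xi2 lam \<le> 213/500 * (lam^2 * sqrt lam) / lam^3"
    unfolding Xi2_eq[OF assms] using assms by (intro divide_right_mono xi_num2_le floor_bounds) auto
  also have "\<dots> = 213/500 * (sqrt lam / lam)" using assms by (simp add: power_numeral_reduce)
  also have "sqrt lam / lam = 1 / sqrt lam" using assms by (simp add: sqrt_divide_self_eq inverse_eq_divide)
  finally show ?thesis by simp
qed

section \<open>The range \<lambda> \<le> 1\<close>

lemma exp_minus_bounds:
  fixes x :: real assumes "0 \<le> x"
  shows "exp (-x) \<le> 1 - x + x^2/2" "1 - x + x^2/2 - x^3/6 \<le> exp (-x)"
proof -
  have mono: "f 0 \<le> f x" if "\<And>t. t \<ge> 0 \<Longrightarrow> (f has_real_derivative f' t) (at t)" "\<And>t. t \<ge> 0 \<Longrightarrow> f' t \<ge> 0" "x \<ge> 0" for f f' :: "real \<Rightarrow> real" and x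
    by (rule DERIV_nonneg_imp_nondecreasing[OF that(3)]) (use that in blast)
  have 0: "1 - t \<le> exp (-t)" for t :: real using exp_ge_add_one_self[of "-t"] by simp
  have 1: "exp (-t) \<le> 1 - t + t^2/2" if t: "t \<ge> 0" for t :: real
  proof -
    have "(\<lambda>t. 1 - t + t^2/2 - exp (-t)) 0 \<le> (\<lambda>t. 1 - t + t^2/2 - exp (-t)) t"
      by (rule mono[where f' = "\<lambda>t. -1 + t + exp (-t)"])
        (use 0 t in \<open>auto intro!: derivative_eq_intros simp: algebra_simps\<close>)
    then show ?thesis by simp
  qed
  show "exp (-x) \<le> 1 - x + x^2/2" using 1 assms .
  have "(\<lambda>t. exp (-t) - (1 - t + t^2/2 - t^3/6)) 0 \<le> (\<lambda>t. exp (-t) - (1 - t + t^2/2 - t^3/6)) x"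
    by (rule mono[where f' = "\<lambda>t. 1 - t + t^2/2 - exp (-t)"])
      (use 1 assms in \<open>auto intro!: derivative_eq_intros simp: algebra_simps\<close>)
  then show "1 - x + x^2/2 - x^3/6 \<le> exp (-x)" by simp
qed

lemma Xi1_le_small:
  assumes "0 < lam" "lam \<le> 1" shows "Xi1 lam \<le> 1/2"
  using exp_minus_bounds(1)[of lam] assms by (simp add: Xi1_def divide_simps)

lemma Xi2_le_small:
  assumes "0 < lam" "lam \<le> 1" shows "Xi2 lam \<le> 1/3"
proof -
  have "3 * ((lam - 1)^2 - 2 * exp (-lam) + 1) \<le> lam^3"
    using exp_minus_bounds(2)[of lam] assms by (simp add: power2_eq_square algebra_simps)
  then show ?thesis using assms by (simp add: Xi2_def divide_simps)
qed

section \<open>The Stein solution\<close>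

lemma pois_sums_1: "pois lam sums 1"
proof -
  have "(\<lambda>n. exp (-lam) * (lam ^ n /\<^sub>R fact n)) sums (exp (-lam) * exp lam)"
    by (intro sums_mult exp_converges)
  then show ?thesis
    by (simp add: pois_def[abs_def] exp_add[symmetric] divide_inverse mult.assoc mult.commute[of "inverse _"])
qed

definition pois_integrable :: "real \<Rightarrow> (nat \<Rightarrow> real) \<Rightarrow> bool" where
  "pois_integrable lam f \<longleftrightarrow> summable (\<lambda>i. \<bar>f i\<bar> * pois lam i)"

context
  fixes lam :: real
  assumes lam_pos: "lam > 0"
begin

lemma pois_gt0 [simp]: "pois lam k > 0" "pois lam k \<ge> 0" "pois lam k \<noteq> 0"
  using pois_pos[OF lam_pos, of k] by auto

lemma pois_integrable_summable: "pois_integrable lam f \<Longrightarrow> summable (\<lambda>i. f i * pois lam i)"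
  unfolding pois_integrable_def by (rule summable_rabs_cancel) (simp add: abs_mult)

lemma pois_integrable_const: "pois_integrable lam (\<lambda>_. c)"
  unfolding pois_integrable_def using pois_sums_1 by (intro summable_mult) (auto simp: sums_iff)

lemma pois_integrable_le:
  assumes "pois_integrable lam g" "\<And>i. \<bar>f i\<bar> \<le> \<bar>g i\<bar>"
  shows "pois_integrable lam f"
  using assms(1) unfolding pois_integrable_def
  by (rule summable_comparison_test'[where N=0]) (simp add: abs_mult mult_right_mono assms)

lemma pois_integrable_add:
  assumes "pois_integrable lam f" "pois_integrable lam g"
  shows "pois_integrable lam (\<lambda>i. f i + g i)"
proof -
  have "summable (\<lambda>i. \<bar>f i\<bar> * pois lam i + \<bar>g i\<bar> * pois lam i)"
    using assms unfolding pois_integrable_def by (rule summable_add)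
  then have "pois_integrable lam (\<lambda>i. \<bar>f i\<bar> + \<bar>g i\<bar>)"
    by (simp add: pois_integrable_def distrib_right)
  then show ?thesis by (rule pois_integrable_le) linarith
qed

lemma pois_integrable_abs: "pois_integrable lam f \<Longrightarrow> pois_integrable lam (\<lambda>i. \<bar>f i\<bar>)"
  by (simp add: pois_integrable_def)

lemma pois_integrable_cmult: "pois_integrable lam f \<Longrightarrow> pois_integrable lam (\<lambda>i. c * f i)"
  unfolding pois_integrable_def by (simp add: abs_mult mult.assoc summable_mult)

lemma pois_integrable_finite_support:
  assumes "\<And>k. k \<ge> N \<Longrightarrow> f k = 0" shows "pois_integrable lam f"
  unfolding pois_integrable_def by (rule summable_finite[of "{..<N}"]) (use assms in \<open>auto simp: not_less\<close>)

lemma pois_integrable_real: "pois_integrable lam real"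
proof -
  have "summable (\<lambda>k. lam * pois lam k)" using pois_sums_1 by (intro summable_mult) (auto simp: sums_iff)
  then have "summable (\<lambda>k. real (Suc k) * pois lam (Suc k))" by (simp only: pois_Suc)
  then show ?thesis unfolding pois_integrable_def using summable_Suc_iff[of "\<lambda>k. real k * pois lam k"] by simp
qed

lemma pexp_real: "pexp lam real = lam"
proof -
  have "(\<lambda>k. lam * pois lam k) sums (lam * 1)" by (rule sums_mult[OF pois_sums_1])
  then have "(\<lambda>k. real (Suc k) * pois lam (Suc k)) sums lam" by (simp only: pois_Suc mult_1_right)
  then have "(\<lambda>k. real k * pois lam k) sums lam" using sums_Suc_iff[of "\<lambda>k. real k * pois lam k" lam] by simp
  then show ?thesis by (simp add: pexp_def sums_iff)
qed

section \<open>The distribution function and the coefficients of the kernel\<close>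

definition pcdf :: "nat \<Rightarrow> real" where "pcdf i = (\<Sum>k\<le>i. pois lam k)"

lemma pcdf_Suc: "pcdf (Suc i) = pcdf i + pois lam (Suc i)"
  by (simp add: pcdf_def)

lemma pcdf_bounds: "0 < pcdf i" "pcdf i \<le> 1"
proof -
  show "0 < pcdf i" unfolding pcdf_def by (rule sum_pos) auto
  have "(\<Sum>k\<in>{..i}. pois lam k) \<le> suminf (pois lam)"
    by (rule sum_le_suminf) (use pois_sums_1 in \<open>auto simp: sums_iff\<close>)
  then show "pcdf i \<le> 1" using pois_sums_1 by (simp add: pcdf_def sums_iff)
qed

text \<open>Since \<open>lam * pois lam i = (i + 1) * pois lam (i + 1)\<close>,
  \<open>alow i\<close> and \<open>bup i\<close> are the coefficients belonging to the Stein
  solution at i + 1, not at i.\<close>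

definition alow :: "nat \<Rightarrow> real" where "alow i = pcdf i / (lam * pois lam i)"
definition bup :: "nat \<Rightarrow> real" where "bup i = (1 - pcdf i) / (lam * pois lam i)"

lemma pois_Suc_eq: "pois lam (Suc i) = lam * pois lam i / (real i + 1)"
  using pois_Suc[of i lam] by (simp add: field_simps)

lemma alow_0: "lam * alow 0 = 1"
  using lam_pos by (simp add: alow_def pcdf_def)

lemma pois_Suc': "lam * pois lam i = (real i + 1) * pois lam (Suc i)"
  using pois_Suc[of i lam] by (simp add: add.commute)

lemma alow_Suc: "lam * alow (Suc i) = 1 + (real i + 1) * alow i"
proof -
  have "real i + 1 \<noteq> 0" by linarith
  then show ?thesis
    using lam_pos unfolding alow_def pcdf_Suc pois_Suc'[of i] by (simp add: add_divide_distrib distrib_left)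
qed

lemma bup_Suc: "lam * bup (Suc i) = (real i + 1) * bup i - 1"
proof -
  have "real i + 1 \<noteq> 0" by linarith
  then show ?thesis
    using lam_pos unfolding bup_def pcdf_Suc pois_Suc'[of i] by (simp add: divide_simps)
qed

text \<open>Moving the base point of the two deviations by one step changes them by the multiples
  \<open>pcdf\<close> and \<open>1 - pcdf\<close> of one increment; this identity makes the two
  changes cancel in \<open>gsol_diff\<close>.\<close>

lemma alow_bup: "bup i * pcdf i = alow i * (1 - pcdf i)"
  by (simp add: alow_def bup_def)

lemma alow_nonneg: "alow i \<ge> 0"
  using pcdf_bounds[of i] lam_pos by (simp add: alow_def)

lemma alow_diff_Suc: "lam * (alow (Suc (Suc i)) - alow (Suc i)) = alow (Suc i) + (real i + 1) * (alow (Suc i) - alow i)"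
  using alow_Suc[of i] alow_Suc[of "Suc i"] by (simp add: algebra_simps)

lemma alow_mono: "alow i \<le> alow (Suc i)"
proof (induction i)
  case 0
  have "lam * (alow (Suc 0) - alow 0) \<ge> 0"
    using alow_Suc[of 0] alow_0 alow_nonneg[of 0] by (simp add: algebra_simps)
  then show ?case using lam_pos by (simp add: zero_le_mult_iff)
next
  case (Suc i)
  have "lam * (alow (Suc (Suc i)) - alow (Suc i)) \<ge> 0"
    unfolding alow_diff_Suc using Suc alow_nonneg[of "Suc i"] by simp
  then show ?case using lam_pos by (simp add: zero_le_mult_iff)
qed

text \<open>Differencing the recursion once more gives \<lambda> \<Delta>^2 a(i+1) = 2
  \<Delta>a(i+1) + (i+1) \<Delta>^2 a(i), with positive coefficients, so that signs propagate by
  induction.\<close>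

lemma alow_convex: "alow (Suc i) - alow i \<le> alow (Suc (Suc i)) - alow (Suc i)"
proof (induction i)
  case 0
  have "lam * (alow (Suc (Suc 0)) - alow (Suc 0)) - lam * (alow (Suc 0) - alow 0) = 2 * (alow (Suc 0) - alow 0)"
    using alow_diff_Suc[of 0] alow_Suc[of 0] alow_0 by (simp add: algebra_simps)
  then have "lam * (alow (Suc (Suc 0)) - alow (Suc 0) - (alow (Suc 0) - alow 0)) \<ge> 0"
    using alow_mono[of 0] by (simp add: algebra_simps)
  then show ?case using lam_pos by (simp add: zero_le_mult_iff)
next
  case (Suc i)
  define x where "x = alow i" define y where "y = alow (Suc i)" define z where "z = alow (Suc (Suc i))"
  have "lam * (alow (Suc (Suc (Suc i))) - z) - lam * (z - y) = 2 * (z - y) + (real i + 1) * ((z - y) - (y - x))"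
    using alow_diff_Suc[of "Suc i"] alow_diff_Suc[of i] unfolding x_def y_def z_def
    by (simp add: algebra_simps)
  also have "\<dots> \<ge> 0" using Suc alow_mono[of "Suc i"] unfolding x_def y_def z_def
    by (intro add_nonneg_nonneg mult_nonneg_nonneg) auto
  finally have "lam * (alow (Suc (Suc (Suc i))) - z - (z - y)) \<ge> 0" by (simp add: algebra_simps)
  then show ?case using lam_pos by (simp add: zero_le_mult_iff z_def y_def)
qed

text \<open>The recursion \<open>bup_Suc\<close> contains -1 and does not propagate signs. As
  moments of a positive weight on [0, 1], the sequence has differences with integrands x^i (1-x) and
  x^i (1-x)^2 times the weight, which gives \<open>bup_antimono\<close> and
  \<open>bup_convex\<close>.\<close>

lemma bup_integral: "((\<lambda>x. x ^ i * exp (lam * (1 - x))) has_integral bup i) {0..1}"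
proof (induction i)
  case 0
  have "((\<lambda>x. exp (lam * (1 - x))) has_integral (- exp (lam * (1 - 1)) / lam - - exp (lam * (1 - 0)) / lam)) {0..1}"
    using lam_pos
    by (intro fundamental_theorem_of_calculus[where f = "\<lambda>x. - exp (lam * (1 - x)) / lam"])
      (auto intro!: derivative_eq_intros simp: has_real_derivative_iff_has_vector_derivative[symmetric])
  moreover have "bup 0 = (- exp (lam * (1 - 1)) / lam - - exp (lam * (1 - 0)) / lam)"
    using lam_pos by (simp add: bup_def pcdf_def pois_def exp_minus field_simps)
  ultimately show ?case by simp
next
  case (Suc i)
  \<comment> \<open>Integration by parts: the derivative of this function integrates to -1,
    reproducing \<open>bup_Suc\<close>.\<close>
  let ?f = "\<lambda>x::real. - (x ^ Suc i * exp (lam * (1 - x)))"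
  have "((\<lambda>x. lam * (x ^ Suc i * exp (lam * (1 - x))) - (real i + 1) * (x ^ i * exp (lam * (1 - x)))) has_integral (?f 1 - ?f 0)) {0..1}"
  proof (intro fundamental_theorem_of_calculus)
    fix x :: real
    have "(?f has_real_derivative (lam * (x ^ Suc i * exp (lam * (1 - x))) - (real i + 1) * (x ^ i * exp (lam * (1 - x))))) (at x within {0..1})"
      by (rule derivative_eq_intros refl | simp)+
    then show "(?f has_vector_derivative (lam * (x ^ Suc i * exp (lam * (1 - x))) - (real i + 1) * (x ^ i * exp (lam * (1 - x))))) (at x within {0..1})"
      by (simp add: has_real_derivative_iff_has_vector_derivative)
  qed simp
  from has_integral_add[OF this has_integral_mult_right[OF Suc, of "real i + 1"]]
  have "((\<lambda>x. lam * (x ^ Suc i * exp (lam * (1 - x)))) has_integral (lam * bup (Suc i))) {0..1}"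
    by (simp add: bup_Suc)
  from has_integral_mult_right[OF this, of "1 / lam"] show ?case using lam_pos by simp
qed

lemma bup_antimono: "bup (Suc i) \<le> bup i"
  by (rule has_integral_le[OF bup_integral bup_integral]) (auto intro!: mult_right_mono mult_left_le_one_le)

lemma bup_convex: "bup (Suc i) - bup (Suc (Suc i)) \<le> bup i - bup (Suc i)"
proof (rule has_integral_le[OF has_integral_diff[OF bup_integral bup_integral] has_integral_diff[OF bup_integral bup_integral]])
  fix x :: real assume "x \<in> {0..1}"
  then have "x ^ i * exp (lam * (1 - x)) * (1 - x)^2 \<ge> 0" by simp
  then show "x ^ Suc i * exp (lam * (1 - x)) - x ^ Suc (Suc i) * exp (lam * (1 - x))
     \<le> x ^ i * exp (lam * (1 - x)) - x ^ Suc i * exp (lam * (1 - x))"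
    by (simp add: algebra_simps power2_eq_square)
qed

section \<open>The Stein solution and its differences in terms of increments of f\<close>

definition dev_below :: "(nat \<Rightarrow> real) \<Rightarrow> nat \<Rightarrow> real" where
  "dev_below f n = (\<Sum>j<n. pois lam j * (f n - f j))"

text \<open>\<open>max j n\<close> annihilates the terms with j \<le> n, so that the upper deviation
  is a Poisson mean. By parts the two deviations are sums of increments of f, weighted by
  \<open>pcdf\<close> below n and by \<open>1 - pcdf\<close> from n on.\<close>

definition dev_above :: "(nat \<Rightarrow> real) \<Rightarrow> nat \<Rightarrow> real" where
  "dev_above f n = pexp lam (\<lambda>j. f (max j n) - f n)"

lemma pois_integrable_dev_above:
  assumes "pois_integrable lam f"
  shows "pois_integrable lam (\<lambda>j. f (max j n) - f n)"
proof -
  have "pois_integrable lam (\<lambda>j. \<bar>f j\<bar> + 2 * \<bar>f n\<bar>)"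
    by (intro pois_integrable_add pois_integrable_abs assms pois_integrable_const)
  then show ?thesis by (rule pois_integrable_le) (auto simp: max_def)
qed

lemma pexp_add:
  assumes "pois_integrable lam f" "pois_integrable lam g"
  shows "pexp lam (\<lambda>i. f i + g i) = pexp lam f + pexp lam g"
  using suminf_add[OF assms[THEN pois_integrable_summable]] by (simp add: pexp_def distrib_right)

lemma pexp_const: "pexp lam (\<lambda>_. c) = c"
  using sums_mult[OF pois_sums_1, of c] by (simp add: pexp_def sums_iff)

lemma pexp_finite_support:
  assumes "\<And>k. k \<ge> N \<Longrightarrow> f k = 0" shows "pexp lam f = (\<Sum>k<N. f k * pois lam k)"
  unfolding pexp_def by (rule suminf_finite) (use assms in \<open>auto simp: not_less\<close>)

lemma pexp_eq_dev:
  assumes "pois_integrable lam f"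
  shows "pexp lam f = f n + dev_above f n - dev_below f n"
proof -
  let ?h = "\<lambda>j. if j < n then f j - f n else 0"
  have f: "f = (\<lambda>j. f n + ((f (max j n) - f n) + ?h j))" by (auto simp: max_def fun_eq_iff)
  have i: "pois_integrable lam ?h" by (rule pois_integrable_finite_support[of n]) simp
  have "pexp lam f = f n + (dev_above f n + pexp lam ?h)"
    by (subst f, subst pexp_add)
      (auto intro!: pois_integrable_add pois_integrable_const pois_integrable_dev_above assms i
        simp: pexp_const dev_above_def pexp_add[OF pois_integrable_dev_above[OF assms] i])
  also have "pexp lam ?h = - dev_below f n"
    by (subst pexp_finite_support[of n]) (auto simp: dev_below_def sum_negf[symmetric] algebra_simps intro!: sum.cong)
  finally show ?thesis by simp
qed

lemma dev_below_Suc: "dev_below f (Suc n) = dev_below f n + pcdf n * (f (Suc n) - f n)"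
proof -
  have "pcdf n = (\<Sum>j<n. pois lam j) + pois lam n" by (simp add: pcdf_def lessThan_Suc_atMost[symmetric])
  then show ?thesis
    by (simp add: dev_below_def algebra_simps sum.distrib sum_subtractf sum_distrib_left sum_distrib_right)
qed

lemma dev_above_Suc:
  assumes "pois_integrable lam f"
  shows "dev_above f n = dev_above f (Suc n) + (1 - pcdf n) * (f (Suc n) - f n)"
  using pexp_eq_dev[OF assms, of n] pexp_eq_dev[OF assms, of "Suc n"]
  by (simp add: dev_below_Suc algebra_simps)

lemma gsol_Suc: "gsol lam f (Suc i) = (1 / (lam * pois lam i)) * (\<Sum>k<Suc i. pois lam k * (f k - pexp lam f))"
  unfolding gsol_def Let_def pois_Suc'[of i] by (simp add: add.commute)

lemma gsol_1: "lam * gsol lam f 1 = f 0 - pexp lam f"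
  using gsol_Suc[of f 0] lam_pos by simp

lemma gsol_stein: "lam * gsol lam f (Suc (Suc i)) - (real i + 1) * gsol lam f (Suc i) = f (Suc i) - pexp lam f"
proof -
  define S where "S = (\<Sum>k<Suc i. pois lam k * (f k - pexp lam f))"
  have "lam * gsol lam f (Suc (Suc i)) = (S + pois lam (Suc i) * (f (Suc i) - pexp lam f)) / pois lam (Suc i)"
    using lam_pos by (simp add: gsol_Suc S_def)
  also have "\<dots> = S / pois lam (Suc i) + (f (Suc i) - pexp lam f)" by (simp add: add_divide_distrib)
  also have "S / pois lam (Suc i) = (real i + 1) * gsol lam f (Suc i)"
    using lam_pos by (simp add: gsol_Suc S_def[symmetric] pois_Suc_eq del: sum.lessThan_Suc)
  finally show ?thesis by simp
qed

text \<open>Insert \<open>pexp_eq_dev\<close> with base point i + 1; the value f(i+1) drops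
  out.\<close>

lemma gsol_eq_dev:
  assumes "pois_integrable lam f"
  shows "gsol lam f (Suc i) = - (bup i * dev_below f (Suc i) + alow i * dev_above f (Suc i))"
proof -
  have "(\<Sum>k<Suc i. pois lam k * (f k - pexp lam f)) = - dev_below f (Suc i) + pcdf i * (f (Suc i) - pexp lam f)"
    unfolding dev_below_def pcdf_def lessThan_Suc_atMost sum_distrib_right
    by (simp add: sum_negf[symmetric] sum.distrib[symmetric] algebra_simps)
  also have "\<dots> = - ((1 - pcdf i) * dev_below f (Suc i) + pcdf i * dev_above f (Suc i))"
    unfolding pexp_eq_dev[OF assms, of "Suc i"] by (simp add: algebra_simps)
  finally have "gsol lam f (Suc i) = (1 / (lam * pois lam i)) * - ((1 - pcdf i) * dev_below f (Suc i) + pcdf i * dev_above f (Suc i))"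
    unfolding gsol_Suc by (rule arg_cong)
  also have "\<dots> = - (bup i * dev_below f (Suc i) + alow i * dev_above f (Suc i))"
    unfolding alow_def bup_def by (simp only: minus_add_distrib distrib_left mult_minus_right times_divide_eq_left times_divide_eq_right mult_1_left)
  finally show ?thesis .
qed

text \<open>By \<open>alow_bup\<close> both solutions can be written with deviations at the same
  point i + 1. Only differences of coefficients remain, nonnegative for increments below i + 1 and
  nonpositive from there on: the one sign change of the kernel.\<close>

lemma gsol_diff:
  assumes "pois_integrable lam f"
  shows "gsol lam f (Suc (Suc i)) - gsol lam f (Suc i) =
    (bup i - bup (Suc i)) * dev_below f (Suc i) - (alow (Suc i) - alow i) * dev_above f (Suc i)"
proof -
  have "gsol lam f (Suc (Suc i)) = - (bup (Suc i) * dev_below f (Suc i)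
     + (bup (Suc i) * pcdf (Suc i)) * (f (Suc (Suc i)) - f (Suc i)) + alow (Suc i) * dev_above f (Suc (Suc i)))"
    unfolding gsol_eq_dev[OF assms] dev_below_Suc[of f "Suc i"] by (simp add: algebra_simps)
  also have "\<dots> = - (bup (Suc i) * dev_below f (Suc i) + alow (Suc i) * dev_above f (Suc i))"
    unfolding alow_bup dev_above_Suc[OF assms, of "Suc i"] by (simp add: algebra_simps)
  finally show ?thesis unfolding gsol_eq_dev[OF assms, of i] by (simp add: algebra_simps)
qed

text \<open>The coefficient of the single increment f(i+2) - f(i+1) in \<open>gsol_diff2\<close>. It
  is nonnegative, whereas all other increments carry nonpositive coefficients there.\<close>

definition kernel_peak :: "nat \<Rightarrow> real" where
  "kernel_peak i = (bup (Suc i) - bup (Suc (Suc i))) * pcdf (Suc i) + (alow (Suc i) - alow i) * (1 - pcdf (Suc i))"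

lemma gsol_diff2:
  assumes "pois_integrable lam f"
  shows "gsol lam f (Suc (Suc (Suc i))) - 2 * gsol lam f (Suc (Suc i)) + gsol lam f (Suc i) =
    - ((bup i - bup (Suc i)) - (bup (Suc i) - bup (Suc (Suc i)))) * dev_below f (Suc i)
    - ((alow (Suc (Suc i)) - alow (Suc i)) - (alow (Suc i) - alow i)) * dev_above f (Suc (Suc i))
    + kernel_peak i * (f (Suc (Suc i)) - f (Suc i))"
proof -
  have "gsol lam f (Suc (Suc (Suc i))) - 2 * gsol lam f (Suc (Suc i)) + gsol lam f (Suc i) =
    ((bup (Suc i) - bup (Suc (Suc i))) * (dev_below f (Suc i) + pcdf (Suc i) * (f (Suc (Suc i)) - f (Suc i)))
      - (alow (Suc (Suc i)) - alow (Suc i)) * dev_above f (Suc (Suc i)))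
    - ((bup i - bup (Suc i)) * dev_below f (Suc i)
      - (alow (Suc i) - alow i) * (dev_above f (Suc (Suc i)) + (1 - pcdf (Suc i)) * (f (Suc (Suc i)) - f (Suc i))))"
    unfolding gsol_diff[OF assms, symmetric] dev_below_Suc[symmetric] dev_above_Suc[OF assms, symmetric] by simp
  moreover have "(b - b') * (D + F * d) - a' * U - (b'' * D - a'' * (U + (1 - F) * d)) =
      - (b'' - (b - b')) * D - (a' - a'') * U + ((b - b') * F + a'' * (1 - F)) * d"
    for b b' b'' D F d a' a'' U :: real by (simp add: algebra_simps)
  ultimately show ?thesis unfolding kernel_peak_def by simp
qed

lemma kernel_peak_nonneg: "kernel_peak i \<ge> 0"
  unfolding kernel_peak_def using bup_antimono[of "Suc i"] alow_mono[of i] pcdf_bounds[of "Suc i"]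
  by (intro add_nonneg_nonneg mult_nonneg_nonneg) auto

text \<open>The recursion and the balance of the coefficients eliminate \<open>bup\<close>, and
  \<lambda> times the peak becomes 1 + (1 - F) \<lambda> (\<Delta>a(i) - \<Delta>a(i+1)); convexity
  of a makes the last term nonpositive.\<close>

lemma kernel_peak_le: "kernel_peak i \<le> 1 / lam"
proof -
  define a where "a = alow i" define a1 where "a1 = alow (Suc i)" define F where "F = pcdf (Suc i)"
  define b where "b = bup (Suc i)"
  have "lam * (a1 - a) \<le> lam * (alow (Suc (Suc i)) - a1)"
    using alow_convex[of i] lam_pos by (simp add: a_def a1_def)
  also have "\<dots> = a1 + (real i + 1) * (a1 - a)" by (simp add: a_def a1_def alow_diff_Suc)
  finally have c: "lam * (a1 - a) - (real i + 1) * (a1 - a) - a1 \<le> 0" by simp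
  have 1: "lam * a1 = 1 + (real i + 1) * a" by (simp add: a_def a1_def alow_Suc)
  have 2: "b * F = a1 * (1 - F)" by (simp add: b_def a1_def F_def alow_bup)
  have 3: "lam * bup (Suc (Suc i)) = (real i + 2) * b - 1" using bup_Suc[of "Suc i"] by (simp add: b_def)
  have "lam * kernel_peak i = (lam * b - lam * bup (Suc (Suc i))) * F + lam * (a1 - a) * (1 - F)"
    by (simp add: kernel_peak_def a_def a1_def F_def b_def algebra_simps)
  also have "\<dots> = F + (lam - real i - 2) * (b * F) + lam * (a1 - a) * (1 - F)"
    unfolding 3 by (simp add: algebra_simps)
  also have "\<dots> = F + (1 - F) * (lam * a1 - (real i + 2) * a1 + lam * (a1 - a))"
    unfolding 2 by (simp add: algebra_simps)
  also have "\<dots> = 1 + (1 - F) * (lam * (a1 - a) - (real i + 1) * (a1 - a) - a1)"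
    unfolding 1 by (simp add: algebra_simps)
  also have "\<dots> \<le> 1"
    using mult_nonneg_nonpos[OF _ c, of "1 - F"] pcdf_bounds(2)[of "Suc i"] by (simp add: F_def)
  finally show ?thesis using lam_pos by (simp add: pos_le_divide_eq mult.commute)
qed

lemma gsol_real: "gsol lam real (Suc i) = -1"
proof -
  have "(\<Sum>k<Suc i. pois lam k * (real k - lam)) = - (lam * pois lam i)"
  proof (induction i)
    case (Suc i)
    then show ?case using pois_Suc[of i lam] by (simp add: algebra_simps)
  qed (simp add: algebra_simps)
  then show ?thesis unfolding gsol_Suc pexp_real using lam_pos by simp
qed

definition kernel_mass :: "nat \<Rightarrow> real" where
  "kernel_mass i = (bup i - bup (Suc i)) * dev_below real (Suc i)"

text \<open>The Stein solution of the identity is constant, so its difference vanishes and the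
  masses of the two signs agree.\<close>

lemma kernel_mass_eq: "kernel_mass i = (alow (Suc i) - alow i) * dev_above real (Suc i)"
  using gsol_diff[OF pois_integrable_real, of i] by (simp add: gsol_real kernel_mass_def)

text \<open>Serves two comparisons: a Lipschitz f against \<rho> with c = 1, and \<rho> against the
  identity with c an increment of \<rho>.\<close>

lemma abs_dev_below_le:
  assumes "\<And>j. j < n \<Longrightarrow> \<bar>f n - f j\<bar> \<le> c * (r n - r j)"
  shows "\<bar>dev_below f n\<bar> \<le> c * dev_below r n"
  unfolding dev_below_def sum_distrib_left
proof (rule order.trans[OF sum_abs sum_mono])
  fix j assume "j \<in> {..<n}"
  then have "pois lam j * \<bar>f n - f j\<bar> \<le> pois lam j * (c * (r n - r j))"
    by (intro mult_left_mono assms) auto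
  then show "\<bar>pois lam j * (f n - f j)\<bar> \<le> c * (pois lam j * (r n - r j))"
    by (simp add: abs_mult mult.left_commute)
qed

lemma abs_dev_above_le:
  assumes f: "pois_integrable lam f" and r: "pois_integrable lam r"
    and le: "\<And>j. n \<le> j \<Longrightarrow> \<bar>f j - f n\<bar> \<le> c * (r j - r n)"
  shows "\<bar>dev_above f n\<bar> \<le> c * dev_above r n"
proof -
  let ?d = "\<lambda>g j. g (max j n) - (g n :: real)"
  have "c * dev_above r n = (\<Sum>j. c * (?d r j * pois lam j))"
    unfolding dev_above_def pexp_def
    by (rule suminf_mult[symmetric], rule pois_integrable_summable, rule pois_integrable_dev_above[OF r])
  moreover have "\<bar>dev_above f n\<bar> \<le> (\<Sum>j. \<bar>?d f j * pois lam j\<bar>)"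
    unfolding dev_above_def pexp_def
    using pois_integrable_dev_above[OF f] by (intro summable_rabs) (simp add: pois_integrable_def abs_mult)
  moreover have "\<dots> \<le> (\<Sum>j. c * (?d r j * pois lam j))"
  proof (rule suminf_le)
    fix j
    have "\<bar>?d f j\<bar> * pois lam j \<le> (c * ?d r j) * pois lam j" by (intro mult_right_mono le) auto
    then show "\<bar>?d f j * pois lam j\<bar> \<le> c * (?d r j * pois lam j)" by (simp add: abs_mult mult.assoc)
  next
    show "summable (\<lambda>j. \<bar>?d f j * pois lam j\<bar>)"
      using pois_integrable_dev_above[OF f] by (simp add: pois_integrable_def abs_mult)
    show "summable (\<lambda>j. c * (?d r j * pois lam j))"
      by (intro summable_mult pois_integrable_summable pois_integrable_dev_above r)
  qed
  ultimately show ?thesis by linarith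
qed

end

section \<open>The semigroup representation\<close>

text \<open>For \<open>f\<close> vanishing on \<open>{N..}\<close> this is the mean of \<open>f(X + Y)\<close>, where \<open>X\<close> is binomial with parameters
  \<open>m\<close>, \<open>1 - s/\<lambda>\<close> and \<open>Y\<close> is an independent Poisson(\<open>s\<close>) variable: the M/M/\<open>\<infinity>\<close> semigroup started at \<open>m\<close>.\<close>

primrec thinned_mean :: "real \<Rightarrow> nat \<Rightarrow> nat \<Rightarrow> (nat \<Rightarrow> real) \<Rightarrow> real \<Rightarrow> real" where
  "thinned_mean lam N 0 = (\<lambda>f s. \<Sum>k<N. f k * pois s k)"
| "thinned_mean lam N (Suc m) =
    (\<lambda>f s. (s / lam) * thinned_mean lam N m f s + (1 - s / lam) * thinned_mean lam N m (\<lambda>k. f (Suc k)) s)"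

lemma thinned_mean_linear:
  "thinned_mean lam N m (\<lambda>k. a * f k + b * g k) s = a * thinned_mean lam N m f s + b * thinned_mean lam N m g s"
proof (induction m arbitrary: f g)
  case 0 show ?case by (simp add: sum.distrib sum_distrib_left algebra_simps)
next
  case (Suc m)
  have "p * (a * x + b * y) + q * (a * x' + b * y') = a * (p * x + q * x') + b * (p * y + q * y')"
    for p q x y x' y' :: real by (simp add: algebra_simps)
  then show ?case unfolding thinned_mean.simps Suc .
qed

lemma thinned_mean_shift_diff:
  "thinned_mean lam N m (\<lambda>k. f (Suc k) - f k) s = thinned_mean lam N m (\<lambda>k. f (Suc k)) s - thinned_mean lam N m f s"
  using thinned_mean_linear[of lam N m 1 "\<lambda>k. f (Suc k)" "-1" f s] by simp

text \<open>One extra initial particle survives with probability 1 - s/\<lambda> and then shifts the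
  state by 1. Each difference in the starting point therefore produces one factor 1 - s/\<lambda>,
  the source of the weights.\<close>

lemma thinned_mean_Suc_diff:
  "thinned_mean lam N (Suc m) f s - thinned_mean lam N m f s = (1 - s / lam) * thinned_mean lam N m (\<lambda>k. f (Suc k) - f k) s"
  by (simp add: thinned_mean_shift_diff algebra_simps)

lemma thinned_mean_mono:
  assumes "0 \<le> s" "s \<le> lam" "\<And>k. f k \<le> g k"
  shows "thinned_mean lam N m f s \<le> thinned_mean lam N m g s"
  using assms(3)
proof (induction m arbitrary: f g)
  case 0 then show ?case using assms(1) by (auto intro!: sum_mono mult_right_mono pois_nonneg)
next
  case (Suc m)
  have "0 \<le> s / lam" "s / lam \<le> 1" using assms(1,2) by (auto simp: divide_le_eq_1)
  then show ?case unfolding thinned_mean.simps using Suc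
    by (intro add_mono mult_left_mono) auto
qed

text \<open>The law is a mixture of shifted Poisson laws, so a uniform bound for Poisson point
  probabilities survives; the offset c absorbs the shift in the induction.\<close>

lemma thinned_mean_indicator_le:
  assumes "0 \<le> s" "s \<le> lam" "\<And>k. pois s k \<le> u"
  shows "thinned_mean lam N m (\<lambda>k. of_bool (k + c = j)) s \<le> u"
proof (induction m arbitrary: c)
  case 0
  have u: "0 \<le> u" using assms(3)[of 0] pois_nonneg[OF assms(1), of 0] by linarith
  have "(\<Sum>k<N. of_bool (k + c = j) * pois s k) = (\<Sum>k\<in>{k. k < N \<and> k + c = j}. pois s k)"
    by (rule sum.mono_neutral_cong_right) auto
  also have "\<dots> \<le> u"
  proof (cases "c \<le> j \<and> j - c < N")
    case True
    then have "{k. k < N \<and> k + c = j} = {j - c}" by auto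
    then show ?thesis using assms(3) by simp
  next
    case False
    then have e: "{k. k < N \<and> k + c = j} = {}" by auto
    show ?thesis unfolding e using u by simp
  qed
  finally show ?case by simp
next
  case (Suc m)
  define p where "p = s / lam"
  have p: "0 \<le> p" "p \<le> 1" using assms by (auto simp: p_def divide_le_eq_1)
  have "p * thinned_mean lam N m (\<lambda>k. of_bool (k + c = j)) s +
      (1 - p) * thinned_mean lam N m (\<lambda>k. of_bool (k + Suc c = j)) s \<le> p * u + (1 - p) * u"
    using p by (intro add_mono mult_left_mono Suc) auto
  then show ?case by (simp add: p_def algebra_simps)
qed

lemma pois_deriv:
  "((\<lambda>s. pois s k) has_real_derivative ((if k = 0 then 0 else pois s (k - 1)) - pois s k)) (at s)"
proof (cases k)
  case 0 then show ?thesis unfolding pois_def by (auto intro!: derivative_eq_intros)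
next
  case (Suc n)
  have "((\<lambda>s. exp (- s)) has_real_derivative - exp (- s)) (at s)"
    by (auto intro!: derivative_eq_intros)
  moreover have "((\<lambda>s. s ^ Suc n) has_real_derivative real (Suc n) * s ^ n) (at s)"
    using DERIV_pow[of "Suc n" s] by simp
  ultimately have "((\<lambda>s. exp (- s) * s ^ Suc n / fact (Suc n)) has_real_derivative
      (- exp (- s) * s ^ Suc n + real (Suc n) * s ^ n * exp (- s)) / fact (Suc n)) (at s)"
    by (intro DERIV_cdivide DERIV_mult)
  then have "((\<lambda>s. pois s k) has_real_derivative
      (exp (- s) * (real (Suc n) * s ^ n) - exp (- s) * s ^ Suc n) / fact (Suc n)) (at s)"
    unfolding pois_def Suc by (simp only: mult_minus_left add.commute[of "- _"] diff_conv_add_uminus mult.commute)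
  moreover have "(exp (- s) * (real (Suc n) * s ^ n)) / fact (Suc n) = pois s n"
    by (simp add: pois_def)
  ultimately show ?thesis by (simp add: Suc diff_divide_distrib pois_def)
qed

text \<open>Summation by parts; the boundary term vanishes once f N = 0.\<close>

lemma thinned_mean_deriv_0:
  "((\<lambda>s. \<Sum>k<N. f k * pois s k) has_real_derivative
     ((\<Sum>k<N. (f (Suc k) - f k) * pois s k) - (if N = 0 then 0 else f N * pois s (N - 1)))) (at s)"
proof (induction N)
  case (Suc N)
  have "((\<lambda>s. (\<Sum>k<N. f k * pois s k) + f N * pois s N) has_real_derivative
     (((\<Sum>k<N. (f (Suc k) - f k) * pois s k) - (if N = 0 then 0 else f N * pois s (N - 1)))
       + f N * ((if N = 0 then 0 else pois s (N - 1)) - pois s N))) (at s)"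
    by (intro DERIV_add Suc DERIV_cmult pois_deriv)
  then show ?case unfolding sum.lessThan_Suc by (rule DERIV_cong) (simp add: algebra_simps)
qed simp

text \<open>Kolmogorov's backward equation in the variable s = \<lambda>(1 - exp(-t)): birth rate
  \<lambda> and death rate m are divided by ds/dt = \<lambda> exp(-t), whose exponential cancels
  against the damping of differences. For m = 0 the index m - 1 is 0, but its coefficient
  vanishes.\<close>

lemma thinned_mean_deriv:
  assumes lam: "lam > 0" and "\<forall>k\<ge>N. f k = 0"
  shows "((\<lambda>s. thinned_mean lam N m f s) has_real_derivative
     (thinned_mean lam N m (\<lambda>k. f (Suc k) - f k) s
       - (real m / lam) * thinned_mean lam N (m - 1) (\<lambda>k. f (Suc k) - f k) s)) (at s)"
  using assms(2)
proof (induction m arbitrary: f)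
  case 0
  then have "f N = 0" by simp
  then show ?case using thinned_mean_deriv_0[of f N s] by (simp cong: if_cong)
next
  case (Suc m)
  define A where "A = thinned_mean lam N m f s"
  define AS where "AS = thinned_mean lam N m (\<lambda>k. f (Suc k)) s"
  define B where "B = (\<lambda>i. thinned_mean lam N i (\<lambda>k. f (Suc k) - f k) s)"
  define BS where "BS = (\<lambda>i. thinned_mean lam N i (\<lambda>k. f (Suc (Suc k)) - f (Suc k)) s)"
  have 1: "((\<lambda>s. thinned_mean lam N m f s) has_real_derivative (B m - (real m / lam) * B (m - 1))) (at s)"
    unfolding B_def by (rule Suc.IH) (rule Suc.prems)
  have 2: "((\<lambda>s. thinned_mean lam N m (\<lambda>k. f (Suc k)) s) has_real_derivative (BS m - (real m / lam) * BS (m - 1))) (at s)"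
    unfolding BS_def by (rule Suc.IH) (simp add: Suc.prems)
  have d: "((\<lambda>s. thinned_mean lam N (Suc m) f s) has_real_derivative
     ((1 / lam) * A + (B m - (real m / lam) * B (m - 1)) * (s / lam)
      + ((0 - 1 / lam) * AS + (BS m - (real m / lam) * BS (m - 1)) * (1 - s / lam)))) (at s)"
    unfolding thinned_mean.simps A_def AS_def
    by (intro DERIV_add DERIV_mult 1 2 DERIV_diff DERIV_const DERIV_cdivide DERIV_ident)
  have B: "B (Suc i) = (s / lam) * B i + (1 - s / lam) * BS i" for i by (simp add: B_def BS_def)
  have "AS - A = B m" by (simp add: A_def AS_def B_def thinned_mean_shift_diff)
  then have AS: "AS = A + B m" by simp
  have Bm: "(real m / lam) * B m = (real m / lam) * ((s / lam) * B (m - 1) + (1 - s / lam) * BS (m - 1))"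
    using B[of "m - 1"] by (cases m) auto
  have "(1 / lam) * A + (B m - (real m / lam) * B (m - 1)) * (s / lam)
      + ((0 - 1 / lam) * AS + (BS m - (real m / lam) * BS (m - 1)) * (1 - s / lam))
     = B (Suc m) - (1 / lam) * B m - (real m / lam) * B m"
  proof -
    have gen: "x * a + (b - c * b') * p + ((0 - x) * (a + b) + (d - c * d') * (1 - p))
      = p * b + (1 - p) * d - x * b - c * (p * b' + (1 - p) * d')" for x a b b' c d d' p :: real
      by (simp add: algebra_simps)
    show ?thesis unfolding AS B[of m] gen by (simp only: Bm)
  qed
  also have "\<dots> = B (Suc m) - (real (Suc m) / lam) * B m" by (simp add: add_divide_distrib algebra_simps)
  finally show ?case using d by (simp only: B_def diff_Suc_1)
qed

lemma thinned_mean_continuous: "continuous_on S (thinned_mean lam N m f)"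
proof (induction m arbitrary: f)
  case 0
  have "continuous_on S (\<lambda>s. pois s k)" for k
    by (rule DERIV_continuous_on) (rule DERIV_subset[OF pois_deriv], simp)
  then show ?case by (auto intro!: continuous_intros simp: thinned_mean.simps)
next
  case (Suc m)
  then show ?case by (auto intro!: continuous_intros simp: divide_inverse)
qed

lemma thinned_mean_at_lam:
  "lam > 0 \<Longrightarrow> thinned_mean lam N m f lam = (\<Sum>k<N. f k * pois lam k)"
  by (induction m arbitrary: f) auto

lemma thinned_mean_at_0:
  assumes "\<forall>k\<ge>N. f k = 0"
  shows "thinned_mean lam N m f 0 = f m"
  using assms
proof (induction m arbitrary: f)
  case 0
  have "(\<Sum>k<N. f k * pois 0 k) = (\<Sum>k<N. if k = 0 then f 0 else 0)"
    by (intro sum.cong) (auto simp: pois_def power_0_left)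
  also have "\<dots> = f 0" using 0 by (cases "N = 0") simp_all
  finally show ?case by simp
next
  case (Suc m) then show ?case by simp
qed

section \<open>The Stein solution as an integral along the semigroup\<close>

definition stein_int :: "real \<Rightarrow> nat \<Rightarrow> (nat \<Rightarrow> real) \<Rightarrow> nat \<Rightarrow> real" where
  "stein_int lam N w m = integral {0..lam} (thinned_mean lam N m w)"

lemma thinned_mean_integrable [intro]: "thinned_mean lam N m f integrable_on {0..lam}"
  by (intro integrable_continuous_interval thinned_mean_continuous)

text \<open>Integrating the backward equation from s = 0, the point mass at m, to s = \<lambda>, the
  Poisson law, leaves a Stein equation for the integrals.\<close>

lemma stein_int_rec:
  assumes lam: "lam > 0" and f: "\<forall>k\<ge>N. f k = 0"
  shows "stein_int lam N (\<lambda>k. f (Suc k) - f k) m - (real m / lam) * stein_int lam N (\<lambda>k. f (Suc k) - f k) (m - 1)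
    = pexp lam f - f m"
proof -
  let ?w = "\<lambda>k. f (Suc k) - f k"
  have a: "((\<lambda>s. thinned_mean lam N m ?w s - (real m / lam) * thinned_mean lam N (m - 1) ?w s) has_integral
     (thinned_mean lam N m f lam - thinned_mean lam N m f 0)) {0..lam}"
  proof (rule fundamental_theorem_of_calculus)
    show "(thinned_mean lam N m f has_vector_derivative thinned_mean lam N m ?w s
        - (real m / lam) * thinned_mean lam N (m - 1) ?w s) (at s within {0..lam})" for s
      unfolding has_real_derivative_iff_has_vector_derivative[symmetric]
      by (rule DERIV_subset[OF thinned_mean_deriv[OF lam f]]) simp
  qed (use lam in simp)
  have b: "((\<lambda>s. thinned_mean lam N m ?w s - (real m / lam) * thinned_mean lam N (m - 1) ?w s) has_integral
     (stein_int lam N ?w m - (real m / lam) * stein_int lam N ?w (m - 1))) {0..lam}"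
    unfolding stein_int_def
    by (intro has_integral_diff has_integral_mult_right integrable_integral thinned_mean_integrable)
  have "stein_int lam N ?w m - (real m / lam) * stein_int lam N ?w (m - 1)
     = thinned_mean lam N m f lam - thinned_mean lam N m f 0"
    by (rule has_integral_unique[OF b a])
  also have "thinned_mean lam N m f lam = pexp lam f"
    unfolding thinned_mean_at_lam[OF lam] using f by (intro pexp_finite_support[OF lam, symmetric]) auto
  finally show ?thesis unfolding thinned_mean_at_0[OF f] .
qed

text \<open>Both sides satisfy the same first-order recursion in m, and at m = 0 the recursion
  itself fixes the value.\<close>

lemma gsol_eq_stein_int:
  assumes lam: "lam > 0" and f: "\<forall>k\<ge>N. f k = 0"
  shows "lam * gsol lam f (Suc m) = - stein_int lam N (\<lambda>k. f (Suc k) - f k) m"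
proof (induction m)
  case 0
  then show ?case using gsol_1[OF lam, of f] stein_int_rec[OF lam f, of 0] by simp
next
  case (Suc m)
  have "lam * gsol lam f (Suc (Suc m)) = (real m + 1) * gsol lam f (Suc m) + f (Suc m) - pexp lam f"
    using gsol_stein[OF lam, of f m] by simp
  also have "(real m + 1) * gsol lam f (Suc m) = - (real (Suc m) / lam) * stein_int lam N (\<lambda>k. f (Suc k) - f k) m"
  proof -
    have "gsol lam f (Suc m) = - stein_int lam N (\<lambda>k. f (Suc k) - f k) m / lam"
      using Suc lam by (simp add: field_simps)
    then show ?thesis by simp
  qed
  finally show ?case using stein_int_rec[OF lam f, of "Suc m"] by simp
qed

lemma gsol_diff_integral:
  assumes lam: "lam > 0" and f: "\<forall>k\<ge>N. f k = 0"
  shows "((\<lambda>s. (1 - s / lam) * thinned_mean lam N m (fdiff 2 f) s) has_integral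
      (- lam * (gsol lam f (Suc (Suc m)) - gsol lam f (Suc m)))) {0..lam}"
proof -
  let ?w = "\<lambda>k. f (Suc k) - f k"
  have "fdiff 2 f = (\<lambda>k. ?w (Suc k) - ?w k)" by (auto simp: numeral_2_eq_2)
  then have e: "(1 - s / lam) * thinned_mean lam N m (fdiff 2 f) s = thinned_mean lam N (Suc m) ?w s - thinned_mean lam N m ?w s" for s
    by (simp only: thinned_mean_Suc_diff)
  have "- lam * (gsol lam f (Suc (Suc m)) - gsol lam f (Suc m)) = stein_int lam N ?w (Suc m) - stein_int lam N ?w m"
    using gsol_eq_stein_int[OF lam f, of m] gsol_eq_stein_int[OF lam f, of "Suc m"]
    by (simp add: algebra_simps)
  then show ?thesis unfolding e stein_int_def
    by (simp only:) (intro has_integral_diff integrable_integral thinned_mean_integrable)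
qed

lemma gsol_diff2_integral:
  assumes lam: "lam > 0" and f: "\<forall>k\<ge>N. f k = 0"
  shows "((\<lambda>s. (1 - s / lam)^2 * thinned_mean lam N m (fdiff 3 f) s) has_integral
      (- lam * (gsol lam f (Suc (Suc (Suc m))) - 2 * gsol lam f (Suc (Suc m)) + gsol lam f (Suc m)))) {0..lam}"
proof -
  have "fdiff 3 f = (\<lambda>k. fdiff 2 f (Suc k) - fdiff 2 f k)" by (auto simp: numeral_2_eq_2 numeral_3_eq_3)
  then have e: "(1 - s / lam)^2 * thinned_mean lam N m (fdiff 3 f) s =
      (1 - s / lam) * thinned_mean lam N (Suc m) (fdiff 2 f) s - (1 - s / lam) * thinned_mean lam N m (fdiff 2 f) s" for s
    by (simp only: right_diff_distrib[symmetric] thinned_mean_Suc_diff power2_eq_square mult.assoc)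
  show ?thesis unfolding e
    using has_integral_diff[OF gsol_diff_integral[OF lam f, of "Suc m"] gsol_diff_integral[OF lam f, of m]]
    by (simp add: algebra_simps)
qed

section \<open>Integrating the step bound\<close>

lemma weighted_integral_le_steps:
  fixes B W w :: "real \<Rightarrow> real"
  assumes B: "continuous_on {0..x} B" and W: "\<And>s. (W has_real_derivative w s) (at s)"
    and w: "continuous_on UNIV w" "\<And>s. s \<le> x \<Longrightarrow> 0 \<le> w s"
    and le: "\<And>n s. n \<ge> 1 \<Longrightarrow> real n \<le> s \<Longrightarrow> s \<le> real n + 1 \<Longrightarrow> s \<le> x \<Longrightarrow> B s \<le> u n"
    and n: "n \<ge> 1" and y: "real n \<le> y" "y \<le> real n + 1" "y \<le> x"
  shows "integral {1..y} (\<lambda>s. w s * B s) \<le> (\<Sum>k\<in>{1..<n}. u k * (W (Suc k) - W k)) + u n * (W y - W n)"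
proof -
  have int: "(\<lambda>s. w s * B s) integrable_on {a..b}" if "0 \<le> a" "b \<le> x" for a b
    using that by (intro integrable_continuous_interval continuous_on_mult continuous_on_subset[OF B]
        continuous_on_subset[OF w(1)]) auto
  have piece: "integral {real n..y} (\<lambda>s. w s * B s) \<le> u n * (W y - W n)"
    if "n \<ge> 1" "real n \<le> y" "y \<le> real n + 1" "y \<le> x" for n y
  proof -
    have "(w has_integral (W y - W n)) {real n..y}"
      using that by (intro fundamental_theorem_of_calculus)
        (auto simp: has_real_derivative_iff_has_vector_derivative[symmetric] intro!: DERIV_subset[OF W])
    from has_integral_mult_left[OF this, of "u n"]
    have *: "((\<lambda>s. w s * u n) has_integral (u n * (W y - W n))) {real n..y}" by (simp add: mult.commute)
    show ?thesis
      by (rule has_integral_le[OF integrable_integral[OF int] *])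
        (use that in \<open>auto intro!: mult_left_mono w le\<close>)
  qed
  have split: "integral {1..y} (\<lambda>s. w s * B s) \<le> integral {1..real n} (\<lambda>s. w s * B s) + u n * (W y - W n)"
    if "n \<ge> 1" "real n \<le> y" "y \<le> real n + 1" "y \<le> x" for n y
  proof -
    have "integral {1..real n} (\<lambda>s. w s * B s) + integral {real n..y} (\<lambda>s. w s * B s) = integral {1..y} (\<lambda>s. w s * B s)"
      using that by (intro Henstock_Kurzweil_Integration.integral_combine int) auto
    then show ?thesis using piece[OF that] by linarith
  qed
  have "real n \<le> x \<Longrightarrow> integral {1..real n} (\<lambda>s. w s * B s) \<le> (\<Sum>k\<in>{1..<n}. u k * (W (Suc k) - W k))"
    using n
  proof (induction n rule: dec_induct)
    case base show ?case by simp
  next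
    case (step m)
    have "integral {1..real (Suc m)} (\<lambda>s. w s * B s) \<le> integral {1..real m} (\<lambda>s. w s * B s) + u m * (W (Suc m) - W m)"
      by (rule split) (use step in auto)
    also have "\<dots> \<le> (\<Sum>k\<in>{1..<m}. u k * (W (Suc k) - W k)) + u m * (W (Suc m) - W m)"
      using step by simp
    also have "\<dots> = (\<Sum>k\<in>{1..<Suc m}. u k * (W (Suc k) - W k))" using step by simp
    finally show ?case .
  qed
  with split[OF n y] y show ?thesis by linarith
qed

text \<open>The bound exp(-s) on [0, 1] and the constants \<open>ubar n\<close> after that are
  integrated exactly against the weight; \<open>E1\<close>, \<open>E2\<close> and \<open>W1\<close>,
  \<open>W2\<close> are the antiderivatives.\<close>

lemma weighted_integral_le_Xi:
  fixes B :: "real \<Rightarrow> real"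
  assumes lam: "lam > 0" and B: "continuous_on {0..lam} B"
    and B0: "\<And>s. 0 \<le> s \<Longrightarrow> s \<le> 1 \<Longrightarrow> s \<le> lam \<Longrightarrow> B s \<le> exp (- s)"
    and Bn: "\<And>n s. n \<ge> 1 \<Longrightarrow> real n \<le> s \<Longrightarrow> s \<le> real n + 1 \<Longrightarrow> s \<le> lam \<Longrightarrow> B s \<le> ubar n"
  shows "integral {0..lam} (\<lambda>s. (lam - s) * B s) \<le> lam^2 * Xi1 lam"
    and "integral {0..lam} (\<lambda>s. (lam - s)^2 * B s) \<le> lam^3 * Xi2 lam"
proof -
  define W1 where "W1 = (\<lambda>s. - ((lam - s)^2 / 2))"
  define W2 where "W2 = (\<lambda>s. - ((lam - s)^3 / 3))"
  define E1 where "E1 = (\<lambda>s. (s - lam + 1) * exp (- s))"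
  define E2 where "E2 = (\<lambda>s. - (((lam - s)^2 - 2 * (lam - s) + 2) * exp (- s)))"
  have W1: "(W1 has_real_derivative (lam - s)) (at s)" for s
    unfolding W1_def by (auto intro!: derivative_eq_intros simp: field_simps)
  have W2: "(W2 has_real_derivative (lam - s)^2) (at s)" for s
    unfolding W2_def by (auto intro!: derivative_eq_intros)
  have E1: "((\<lambda>s. (lam - s) * exp (- s)) has_integral (E1 y - E1 0)) {0..y}" if "y \<ge> 0" for y
    using that unfolding E1_def
    by (intro fundamental_theorem_of_calculus)
      (auto simp: has_real_derivative_iff_has_vector_derivative[symmetric] algebra_simps intro!: derivative_eq_intros)
  have E2: "((\<lambda>s. (lam - s)^2 * exp (- s)) has_integral (E2 y - E2 0)) {0..y}" if "y \<ge> 0" for y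
    using that unfolding E2_def
    by (intro fundamental_theorem_of_calculus)
      (auto simp: has_real_derivative_iff_has_vector_derivative[symmetric] algebra_simps power2_eq_square intro!: derivative_eq_intros)
  have int: "(\<lambda>s. (lam - s)^q * B s) integrable_on {a..b}" if "0 \<le> a" "b \<le> lam" for a b q
    using that by (intro integrable_continuous_interval continuous_intros continuous_on_subset[OF B]) auto
  have first: "integral {0..y} (\<lambda>s. (lam - s)^q * B s) \<le> I"
    if "((\<lambda>s. (lam - s)^q * exp (- s)) has_integral I) {0..y}" "0 \<le> y" "y \<le> 1" "y \<le> lam" for q y I
    by (rule has_integral_le[OF integrable_integral[OF int] that(1)])
      (use that in \<open>auto intro!: mult_left_mono B0\<close>)
  show "integral {0..lam} (\<lambda>s. (lam - s) * B s) \<le> lam^2 * Xi1 lam"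
  proof (cases "lam \<le> 1")
    case True
    have "integral {0..lam} (\<lambda>s. (lam - s)^1 * B s) \<le> E1 lam - E1 0"
      by (rule first) (use E1[of lam] lam True in auto)
    then show ?thesis using lam True by (simp add: Xi1_def E1_def)
  next
    case False
    define n where "n = nat \<lfloor>lam\<rfloor>"
    have n: "n \<ge> 1" "real n \<le> lam" "lam \<le> real n + 1" using floor_bounds[of lam] False by (auto simp: n_def)
    have "integral {0..1} (\<lambda>s. (lam - s)^1 * B s) \<le> E1 1 - E1 0"
      by (rule first) (use E1[of 1] lam False in auto)
    moreover have "integral {1..lam} (\<lambda>s. (lam - s) * B s)
        \<le> (\<Sum>k\<in>{1..<n}. ubar k * (W1 (Suc k) - W1 k)) + ubar n * (W1 lam - W1 n)"
      by (rule weighted_integral_le_steps[OF B W1 _ _ Bn n]) (use False in \<open>auto intro!: continuous_intros\<close>)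
    moreover have "integral {0..1} (\<lambda>s. (lam - s) * B s) + integral {1..lam} (\<lambda>s. (lam - s) * B s)
        = integral {0..lam} (\<lambda>s. (lam - s) * B s)"
      using False int[of 0 lam 1] by (intro Henstock_Kurzweil_Integration.integral_combine) auto
    moreover have "(\<Sum>k\<in>{1..<n}. ubar k * (W1 (Suc k) - W1 k)) = (\<Sum>k\<in>{1..<n}. ubar k * (lam - k - 1/2))"
      by (intro sum.cong refl arg_cong2[where f="(*)"]) (simp add: W1_def power2_eq_square field_simps)
    moreover have "W1 lam - W1 n = (lam - n)^2 / 2" by (simp add: W1_def)
    moreover have "E1 1 - E1 0 = ((exp 1 - 1) * (lam - 1) + 1) / exp 1"
      by (simp add: E1_def exp_minus field_simps)
    ultimately have "integral {0..lam} (\<lambda>s. (lam - s) * B s) \<le> xi_num1 n lam"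
      by (simp add: xi_num1_def)
    then show ?thesis using False Xi1_eq[of lam] by (simp add: n_def)
  qed
  show "integral {0..lam} (\<lambda>s. (lam - s)^2 * B s) \<le> lam^3 * Xi2 lam"
  proof (cases "lam \<le> 1")
    case True
    have "integral {0..lam} (\<lambda>s. (lam - s)^2 * B s) \<le> E2 lam - E2 0"
      by (rule first) (use E2[of lam] lam True in auto)
    also have "\<dots> = lam^3 * Xi2 lam"
      using lam True by (simp add: Xi2_def E2_def) (simp add: power2_eq_square algebra_simps)
    finally show ?thesis .
  next
    case False
    define n where "n = nat \<lfloor>lam\<rfloor>"
    have n: "n \<ge> 1" "real n \<le> lam" "lam \<le> real n + 1" using floor_bounds[of lam] False by (auto simp: n_def)
    have "integral {0..1} (\<lambda>s. (lam - s)^2 * B s) \<le> E2 1 - E2 0"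
      by (rule first) (use E2[of 1] lam False in auto)
    moreover have "integral {1..lam} (\<lambda>s. (lam - s)^2 * B s)
        \<le> (\<Sum>k\<in>{1..<n}. ubar k * (W2 (Suc k) - W2 k)) + ubar n * (W2 lam - W2 n)"
      by (rule weighted_integral_le_steps[OF B W2 _ _ Bn n]) (use False in \<open>auto intro!: continuous_intros\<close>)
    moreover have "integral {0..1} (\<lambda>s. (lam - s)^2 * B s) + integral {1..lam} (\<lambda>s. (lam - s)^2 * B s)
        = integral {0..lam} (\<lambda>s. (lam - s)^2 * B s)"
      using False int[of 0 lam 2] by (intro Henstock_Kurzweil_Integration.integral_combine) auto
    moreover have "(\<Sum>k\<in>{1..<n}. ubar k * (W2 (Suc k) - W2 k)) = (\<Sum>k\<in>{1..<n}. ubar k * (3 * (lam - k)^2 - 3 * (lam - k) + 1) / 3)"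
      by (intro sum.cong refl, subst times_divide_eq_right[symmetric], intro arg_cong2[where f="(*)"] refl)
        (simp add: W2_def power2_eq_square power3_eq_cube field_simps)
    moreover have "W2 lam - W2 n = (lam - n)^3 / 3" by (simp add: W2_def)
    moreover have "E2 1 - E2 0 = ((exp 1 - 1) * (lam - 1)^2 + 2 * lam + exp 1 - 4) / exp 1"
      by (simp add: E2_def exp_minus power2_eq_square field_simps)
    ultimately have "integral {0..lam} (\<lambda>s. (lam - s)^2 * B s) \<le> xi_num2 n lam"
      by (simp add: xi_num2_def)
    then show ?thesis using False Xi2_eq[of lam] by (simp add: n_def)
  qed
qed

section \<open>Mass of the exceptional part of the kernels\<close>

text \<open>The form \<open>k + 0\<close> matches the offset in
  \<open>thinned_mean_indicator_le\<close> with c = 0.\<close>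

lemma thinned_mean_indicator_weighted_integral_le:
  assumes lam: "lam > 0"
  shows "integral {0..lam} (\<lambda>s. (lam - s) * thinned_mean lam N m (\<lambda>k. of_bool (k + 0 = j)) s) \<le> lam^2 * Xi1 lam"
    and "integral {0..lam} (\<lambda>s. (lam - s)^2 * thinned_mean lam N m (\<lambda>k. of_bool (k + 0 = j)) s) \<le> lam^3 * Xi2 lam"
proof -
  have c: "continuous_on {0..lam} (thinned_mean lam N m (\<lambda>k. of_bool (k + 0 = j)))"
    by (rule thinned_mean_continuous)
  have 0: "thinned_mean lam N m (\<lambda>k. of_bool (k + 0 = j)) s \<le> exp (- s)" if "0 \<le> s" "s \<le> 1" "s \<le> lam" for s
    using that by (intro thinned_mean_indicator_le pois_le_exp)
  have n: "thinned_mean lam N m (\<lambda>k. of_bool (k + 0 = j)) s \<le> ubar n"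
    if "n \<ge> 1" "real n \<le> s" "s \<le> real n + 1" "s \<le> lam" for n s
    using that by (intro thinned_mean_indicator_le pois_le_ubar) auto
  show "integral {0..lam} (\<lambda>s. (lam - s) * thinned_mean lam N m (\<lambda>k. of_bool (k + 0 = j)) s) \<le> lam^2 * Xi1 lam"
    "integral {0..lam} (\<lambda>s. (lam - s)^2 * thinned_mean lam N m (\<lambda>k. of_bool (k + 0 = j)) s) \<le> lam^3 * Xi2 lam"
    using weighted_integral_le_Xi[OF lam c 0 n] by auto
qed

context
  fixes lam :: real
  assumes lam_pos: "lam > 0"
begin

lemma dev_above_eq_0:
  assumes "\<And>j. n \<le> j \<Longrightarrow> f j = f n"
  shows "dev_above lam f n = 0"
proof -
  have "f (max j n) = f n" for j by (rule assms) simp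
  then show ?thesis by (simp add: dev_above_def[OF lam_pos] pexp_def)
qed

lemma kernel_mass_le: "kernel_mass lam i \<le> Xi1 lam"
proof -
  \<comment> \<open>The identity below i + 1, flat above, and shifted to have finite support. The
    upper deviation vanishes, so the first difference of the Stein solution is the mass itself,
    while the second difference of f is minus the indicator of i.\<close>
  define f where "f = (\<lambda>k. real (min k (Suc i)) - real (Suc i))"
  have f0: "\<forall>k\<ge>Suc i. f k = 0" by (simp add: f_def min_def)
  have i: "pois_integrable lam f" using pois_integrable_finite_support[OF lam_pos, of "Suc i" f] f0 by blast
  have d: "dev_below lam f (Suc i) = dev_below lam real (Suc i)"
    unfolding dev_below_def[OF lam_pos] by (intro sum.cong) (auto simp: f_def min_def)
  have u: "dev_above lam f (Suc i) = 0" by (rule dev_above_eq_0) (simp add: f_def min_def)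
  have k: "gsol lam f (Suc (Suc i)) - gsol lam f (Suc i) = kernel_mass lam i"
    unfolding gsol_diff[OF lam_pos i] d u kernel_mass_def[OF lam_pos] by simp
  \<comment> \<open>The products \<open>0 * 0\<close> and \<open>(-1) * _\<close> fit the pattern of
    \<open>thinned_mean_linear\<close>.\<close>
  have f2: "fdiff 2 f = (\<lambda>k. 0 * 0 + (-1) * of_bool (k + 0 = i))"
    by (auto simp: fun_eq_iff numeral_2_eq_2 f_def min_def)
  define B where "B = thinned_mean lam (Suc i) i (\<lambda>k. of_bool (k + 0 = i))"
  have "thinned_mean lam (Suc i) i (fdiff 2 f) s = - B s" for s
    unfolding f2 thinned_mean_linear B_def by simp
  with gsol_diff_integral[OF lam_pos f0, of i]
  have "((\<lambda>s. (1 - s / lam) * - B s) has_integral (- lam * kernel_mass lam i)) {0..lam}"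
    unfolding k by simp
  from has_integral_mult_right[OF this, of "- lam"]
  have "((\<lambda>s. - lam * ((1 - s / lam) * - B s)) has_integral (lam^2 * kernel_mass lam i)) {0..lam}"
    by (simp add: power2_eq_square mult.assoc)
  moreover have "- lam * ((1 - s / lam) * - B s) = (lam - s) * B s" for s
    using lam_pos by (simp add: field_simps)
  ultimately have "((\<lambda>s. (lam - s) * B s) has_integral (lam^2 * kernel_mass lam i)) {0..lam}"
    by (simp only:)
  then have "lam^2 * kernel_mass lam i \<le> lam^2 * Xi1 lam"
    using thinned_mean_indicator_weighted_integral_le(1)[OF lam_pos, of "Suc i" i i] integral_unique
    unfolding B_def by metis
  then show ?thesis using lam_pos by simp
qed

lemma kernel_peak_le_Xi2: "kernel_peak lam i \<le> 2 * Xi2 lam"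
proof -
  \<comment> \<open>A unit jump from i + 1 to i + 2 and no other increment, so only the peak
    coefficient survives in \<open>gsol_diff2\<close>. Subtracting 1 from the indicator of {i + 2,
    ...} gives finite support.\<close>
  define f where "f = (\<lambda>k. - of_bool (k < Suc (Suc i)) :: real)"
  have f0: "\<forall>k\<ge>Suc (Suc i). f k = 0" by (simp add: f_def)
  have i: "pois_integrable lam f" using pois_integrable_finite_support[OF lam_pos, of "Suc (Suc i)" f] f0 by blast
  have d: "dev_below lam f (Suc i) = 0"
    unfolding dev_below_def[OF lam_pos] by (intro sum.neutral) (auto simp: f_def)
  have u: "dev_above lam f (Suc (Suc i)) = 0" by (rule dev_above_eq_0) (simp add: f_def)
  have k: "gsol lam f (Suc (Suc (Suc i))) - 2 * gsol lam f (Suc (Suc i)) + gsol lam f (Suc i) = kernel_peak lam i"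
    unfolding gsol_diff2[OF lam_pos i] d u by (simp add: f_def)
  \<comment> \<open>The third difference is 1, -2, 1 at i - 1, i, i + 1 (the first absent for i =
    0); dropping the positive values leaves -2 at i, the source of the factor 2.\<close>
  have f3: "fdiff 3 f k \<ge> 0 * 0 + (-2) * of_bool (k + 0 = i)" for k
    by (auto simp: numeral_3_eq_3 f_def)
  define B where "B = thinned_mean lam (Suc (Suc i)) i (\<lambda>k. of_bool (k + 0 = i))"
  have B: "- 2 * B s \<le> thinned_mean lam (Suc (Suc i)) i (fdiff 3 f) s" if "0 \<le> s" "s \<le> lam" for s
    using thinned_mean_mono[OF that f3, of "Suc (Suc i)" i] unfolding thinned_mean_linear B_def by simp
  have "B integrable_on {0..lam}" "continuous_on {0..lam} B"
    unfolding B_def by (auto intro: thinned_mean_continuous)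
  then have int: "(\<lambda>s. (lam - s)^2 * B s) integrable_on {0..lam}"
    by (intro integrable_continuous_interval continuous_intros)
  have "lam^2 * (- lam * kernel_peak lam i) \<ge> - 2 * integral {0..lam} (\<lambda>s. (lam - s)^2 * B s)"
  proof (rule has_integral_le)
    show "((\<lambda>s. - 2 * ((lam - s)^2 * B s)) has_integral - 2 * integral {0..lam} (\<lambda>s. (lam - s)^2 * B s)) {0..lam}"
      by (intro has_integral_mult_right integrable_integral int)
    show "((\<lambda>s. lam^2 * ((1 - s / lam)^2 * thinned_mean lam (Suc (Suc i)) i (fdiff 3 f) s)) has_integral
        lam^2 * (- lam * kernel_peak lam i)) {0..lam}"
      using has_integral_mult_right[OF gsol_diff2_integral[OF lam_pos f0, of i]] unfolding k .
    fix s assume s: "s \<in> {0..lam}"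
    have "lam^2 * (1 - s / lam)^2 = (lam - s)^2"
      unfolding power_mult_distrib[symmetric] using lam_pos by (simp add: right_diff_distrib)
    then have e: "lam^2 * ((1 - s / lam)^2 * thinned_mean lam (Suc (Suc i)) i (fdiff 3 f) s)
       = (lam - s)^2 * thinned_mean lam (Suc (Suc i)) i (fdiff 3 f) s" by (simp only: mult.assoc[symmetric])
    have "(lam - s)^2 * (- 2 * B s) \<le> (lam - s)^2 * thinned_mean lam (Suc (Suc i)) i (fdiff 3 f) s"
      using s by (intro mult_left_mono B) auto
    then show "- 2 * ((lam - s)^2 * B s) \<le> lam^2 * ((1 - s / lam)^2 * thinned_mean lam (Suc (Suc i)) i (fdiff 3 f) s)"
      unfolding e by (simp only: mult.left_commute)
  qed
  moreover have "integral {0..lam} (\<lambda>s. (lam - s)^2 * B s) \<le> lam^3 * Xi2 lam"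
    unfolding B_def by (rule thinned_mean_indicator_weighted_integral_le(2)[OF lam_pos])
  ultimately have "lam^3 * kernel_peak lam i \<le> lam^3 * (2 * Xi2 lam)"
    by (simp add: power2_eq_square power3_eq_cube)
  then show ?thesis using lam_pos by simp
qed

section \<open>The generator and its inverse\<close>

lemma Qgen_eq_imp_diff:
  assumes "\<forall>i. Qgen lam h i = f i - pexp lam f"
  shows "h (Suc i) - h i = gsol lam f (Suc i)"
proof (induction i)
  case 0
  \<comment> \<open>At state 0 there is no death term, so the equation determines the first
    increment.\<close>
  have "lam * (h 1 - h 0) = lam * gsol lam f 1"
    using assms[THEN spec, of 0] gsol_1[OF lam_pos, of f] by (simp add: Qgen_def)
  then show ?case using lam_pos by simp
next
  case (Suc i)
  have "lam * (h (Suc (Suc i)) - h (Suc i)) - (real i + 1) * (h (Suc i) - h i) = f (Suc i) - pexp lam f"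
    using assms[THEN spec, of "Suc i"] by (simp add: Qgen_def algebra_simps)
  then have "lam * (h (Suc (Suc i)) - h (Suc i)) = lam * gsol lam f (Suc (Suc i))"
    unfolding Suc using gsol_stein[OF lam_pos, of f i] by linarith
  then show ?case using lam_pos by simp
qed

lemma diff_imp_Qgen_eq:
  assumes "\<And>i. h (Suc i) - h i = gsol lam f (Suc i)"
  shows "Qgen lam h i = f i - pexp lam f"
proof (cases i)
  case 0
  then show ?thesis using gsol_1[OF lam_pos, of f] assms[of 0] by (simp add: Qgen_def)
next
  case (Suc k)
  have "h k - h (Suc k) = - gsol lam f (Suc k)" using assms[of k] by simp
  have "Qgen lam h i = lam * (h (Suc (Suc k)) - h (Suc k)) + (real k + 1) * (h k - h (Suc k))"
    by (simp add: Suc Qgen_def)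
  also have "\<dots> = f i - pexp lam f"
    unfolding assms \<open>h k - h (Suc k) = _\<close> Suc using gsol_stein[OF lam_pos, of f k] by simp
  finally show ?thesis .
qed

text \<open>Makes the solution of the generator equation grow at most linearly, hence Poisson
  integrable. From N on the upper deviation is 0, the lower one is bounded, and \<open>bup\<close>
  decreases.\<close>

lemma gsol_bounded_of_eventually_const:
  assumes i: "pois_integrable lam f" and c: "\<And>j. N \<le> j \<Longrightarrow> f j = f N"
  shows "\<exists>C. \<forall>j. \<bar>gsol lam f (Suc j)\<bar> \<le> C"
proof -
  define D where "D = (\<Sum>k<N. pois lam k * \<bar>f N - f k\<bar>)"
  have D: "\<bar>dev_below lam f n\<bar> \<le> D" if "N \<le> n" for n
  proof -
    have "\<bar>dev_below lam f n\<bar> \<le> (\<Sum>k<n. pois lam k * \<bar>f n - f k\<bar>)"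
      unfolding dev_below_def[OF lam_pos] by (rule order.trans[OF sum_abs]) (simp add: abs_mult pois_gt0[OF lam_pos])
    also have "\<dots> = D" unfolding D_def
    proof (rule sum.mono_neutral_cong_right)
      show "\<forall>k\<in>{..<n} - {..<N}. pois lam k * \<bar>f n - f k\<bar> = 0"
      proof
        fix k assume "k \<in> {..<n} - {..<N}"
        then have "f k = f N" "f n = f N" using that by (auto intro!: c)
        then show "pois lam k * \<bar>f n - f k\<bar> = 0" by simp
      qed
      show "pois lam k * \<bar>f n - f k\<bar> = pois lam k * \<bar>f N - f k\<bar>" for k
        by (simp only: c[OF that])
    qed (use that in auto)
    finally show ?thesis .
  qed
  have bup_le: "bup lam j \<le> bup lam 0" for j
    by (induction j) (auto intro: order.trans[OF bup_antimono[OF lam_pos]])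
  have bup_nonneg: "0 \<le> bup lam j" for j
    by (rule has_integral_nonneg[OF bup_integral[OF lam_pos]]) auto
  have large: "\<bar>gsol lam f (Suc j)\<bar> \<le> bup lam 0 * D" if "N \<le> j" for j
  proof -
    have u: "dev_above lam f (Suc j) = 0" using that c by (intro dev_above_eq_0) (metis le_Suc_eq order.trans)
    have "\<bar>gsol lam f (Suc j)\<bar> = bup lam j * \<bar>dev_below lam f (Suc j)\<bar>"
      unfolding gsol_eq_dev[OF lam_pos i] u using bup_nonneg by (simp add: abs_mult)
    also have "\<dots> \<le> bup lam 0 * D"
      using that by (intro mult_mono bup_le D bup_nonneg) auto
    finally show ?thesis .
  qed
  have D0: "0 \<le> bup lam 0 * D" using large[of N] by linarith
  have "\<bar>gsol lam f (Suc j)\<bar> \<le> bup lam 0 * D + (\<Sum>k<N. \<bar>gsol lam f (Suc k)\<bar>)" for j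
  proof (cases "N \<le> j")
    case True
    then show ?thesis using large[OF True] by (meson add_increasing2 abs_ge_zero sum_nonneg)
  next
    case False
    then have "\<bar>gsol lam f (Suc j)\<bar> \<le> (\<Sum>k<N. \<bar>gsol lam f (Suc k)\<bar>)"
      by (intro member_le_sum) auto
    then show ?thesis using D0 by linarith
  qed
  then show ?thesis by blast
qed

text \<open>For a general integrable \<^term>\<open>f\<close> the centred solution need not be \<^term>\<open>pois lam\<close>-integrable,
  and then the description in \<^term>\<open>Qinv\<close> is empty; eventually constant \<^term>\<open>f\<close> avoid this.\<close>

lemma Qinv_diff:
  assumes i: "pois_integrable lam f" and c: "\<And>j. N \<le> j \<Longrightarrow> f j = f N"
  shows "Qinv lam f (Suc k) - Qinv lam f k = - gsol lam f (Suc k)"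
proof -
  define P where "P = (\<lambda>h. summable (\<lambda>i. \<bar>h i\<bar> * pois lam i) \<and> pexp lam h = 0 \<and>
      (\<forall>i. - Qgen lam h i = f i - pexp lam f))"
  have P_diff: "h (Suc k) - h k = - gsol lam f (Suc k)" if "P h" for h k
  proof -
    have "\<forall>i. Qgen lam (\<lambda>i. - h i) i = f i - pexp lam f"
    proof
      fix i
      have "Qgen lam (\<lambda>i. - h i) i = - Qgen lam h i" by (simp add: Qgen_def algebra_simps)
      then show "Qgen lam (\<lambda>i. - h i) i = f i - pexp lam f" using that by (simp add: P_def)
    qed
    from Qgen_eq_imp_diff[OF this, of k] show ?thesis by simp
  qed
  \<comment> \<open>The sum of the forced increments. Boundedness of the Stein solution makes it
    integrable, and subtracting its mean gives the candidate.\<close>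
  define H where "H = (\<lambda>i. - (\<Sum>j<i. gsol lam f (Suc j)))"
  obtain C where C: "\<And>j. \<bar>gsol lam f (Suc j)\<bar> \<le> C" using gsol_bounded_of_eventually_const[OF i c] by blast
  have "\<bar>H i\<bar> \<le> \<bar>C * real i\<bar>" for i
  proof -
    have "\<bar>H i\<bar> \<le> (\<Sum>j<i. C)" unfolding H_def abs_minus_cancel by (rule order.trans[OF sum_abs sum_mono]) (rule C)
    then show ?thesis by (simp add: mult.commute)
  qed
  then have H: "pois_integrable lam H"
    by (rule pois_integrable_le[OF lam_pos pois_integrable_cmult[OF lam_pos pois_integrable_real[OF lam_pos]]])
  define H' where "H' = (\<lambda>i. - pexp lam H + H i)"
  have H': "pois_integrable lam H'" "pexp lam H' = 0" unfolding H'_def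
    by (rule pois_integrable_add[OF lam_pos pois_integrable_const[OF lam_pos] H])
      (subst pexp_add[OF lam_pos pois_integrable_const[OF lam_pos] H], simp add: pexp_const[OF lam_pos])
  have "P H'"
  proof -
    have "- Qgen lam H' i = f i - pexp lam f" for i
    proof -
      have "Qgen lam (\<lambda>i. - H' i) i = f i - pexp lam f"
        by (rule diff_imp_Qgen_eq) (simp add: H'_def H_def)
      moreover have "Qgen lam (\<lambda>i. - H' i) i = - Qgen lam H' i" by (simp add: Qgen_def algebra_simps)
      ultimately show ?thesis by simp
    qed
    then show ?thesis using H' by (simp add: P_def pois_integrable_def)
  qed
  \<comment> \<open>Uniqueness: the increments fix h up to \<open>h 0\<close>, and mean zero fixes
    \<open>h 0\<close>.\<close>
  moreover have "h = H'" if "P h" for h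
  proof -
    have e: "h i = h 0 + H i" for i
    proof (induction i)
      case (Suc i)
      then show ?case using P_diff[OF that, of i] by (simp add: H_def)
    qed (simp add: H_def)
    then have h: "h = (\<lambda>i. h 0 + H i)" by (rule ext)
    have "pexp lam h = pexp lam (\<lambda>i. h 0 + H i)" by (rule arg_cong[OF h])
    also have "\<dots> = h 0 + pexp lam H"
      using pexp_add[OF lam_pos pois_integrable_const[OF lam_pos, of "h 0"] H] by (simp add: pexp_const[OF lam_pos])
    finally have "pexp lam h = h 0 + pexp lam H" .
    then have h0: "h 0 = - pexp lam H" using that by (simp add: P_def)
    show ?thesis unfolding H'_def h0[symmetric] by (rule h)
  qed
  ultimately have "P (THE h. P h)" by (rule theI[of P H'])
  moreover have "Qinv lam f = (THE h. P h)" by (simp add: Qinv_def P_def)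
  ultimately show ?thesis by (simp only: P_diff)
qed

end

section \<open>Comparison with the weight function\<close>

lemma lipnorm_le_iff:
  assumes "\<And>i. \<rho> i < \<rho> (Suc i)"
  shows "lipnorm \<rho> f \<le> 1 \<longleftrightarrow> (\<forall>i. \<bar>f (Suc i) - f i\<bar> \<le> \<rho> (Suc i) - \<rho> i)"
proof -
  have "\<bar>f (Suc i) - f i\<bar> / (\<rho> (Suc i) - \<rho> i) \<le> 1 \<longleftrightarrow> \<bar>f (Suc i) - f i\<bar> \<le> \<rho> (Suc i) - \<rho> i" for i
    using assms[of i] by (simp add: divide_le_eq_1)
  then show ?thesis by (simp add: lipnorm_def SUP_le_iff one_ereal_def)
qed

lemma lipschitz_diff_le:
  fixes f \<rho> :: "nat \<Rightarrow> real"
  assumes "\<And>i. \<bar>f (Suc i) - f i\<bar> \<le> \<rho> (Suc i) - \<rho> i" "i \<le> j"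
  shows "\<bar>f j - f i\<bar> \<le> \<rho> j - \<rho> i"
  using assms(2)
proof (induction j rule: dec_induct)
  case (step n)
  then show ?case using assms(1)[of n] by linarith
qed simp

locale stein_weight =
  fixes lam :: real and \<rho> :: "nat \<Rightarrow> real"
  assumes lam_pos: "lam > 0" and rhoA: "classA lam \<rho>"
begin

lemma rho_less: "\<rho> i < \<rho> (Suc i)"
  using rhoA by (auto simp: classA_def strict_mono_def)

lemma rho_mono: "i \<le> j \<Longrightarrow> \<rho> i \<le> \<rho> j"
  using rhoA by (auto simp: classA_def strict_mono_less_eq)

lemma rho_integrable: "pois_integrable lam \<rho>"
  using rhoA by (simp add: classA_def pois_integrable_def)

abbreviation "unit_lip f \<equiv> (\<forall>i. \<bar>f (Suc i) - f i\<bar> \<le> \<rho> (Suc i) - \<rho> i)"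

lemma lipnorm_1_imp: "lipnorm \<rho> f = 1 \<Longrightarrow> unit_lip f"
  using lipnorm_le_iff[of \<rho> f] rho_less by simp

lemma unit_lip_diff: "unit_lip f \<Longrightarrow> i \<le> j \<Longrightarrow> \<bar>f j - f i\<bar> \<le> \<rho> j - \<rho> i"
  by (rule lipschitz_diff_le) auto

lemma unit_lip_bound:
  assumes "unit_lip f" shows "\<bar>f j\<bar> \<le> \<bar>\<rho> j + (\<bar>f 0\<bar> - \<rho> 0)\<bar>"
  using unit_lip_diff[OF assms, of 0 j] by linarith

lemma unit_lip_integrable:
  assumes "unit_lip f" shows "pois_integrable lam f"
proof (rule pois_integrable_le[OF lam_pos])
  show "pois_integrable lam (\<lambda>j. \<rho> j + (\<bar>f 0\<bar> - \<rho> 0))"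
    by (intro pois_integrable_add[OF lam_pos] rho_integrable pois_integrable_const[OF lam_pos])
  show "\<bar>f j\<bar> \<le> \<bar>\<rho> j + (\<bar>f 0\<bar> - \<rho> 0)\<bar>" for j by (rule unit_lip_bound[OF assms])
qed

lemma unit_lip_dev:
  assumes "unit_lip f"
  shows "\<bar>dev_below lam f n\<bar> \<le> dev_below lam \<rho> n" "\<bar>dev_above lam f n\<bar> \<le> dev_above lam \<rho> n"
proof -
  have "\<bar>dev_below lam f n\<bar> \<le> 1 * dev_below lam \<rho> n"
    by (rule abs_dev_below_le[OF lam_pos]) (use unit_lip_diff[OF assms] in auto)
  moreover have "\<bar>dev_above lam f n\<bar> \<le> 1 * dev_above lam \<rho> n"
    by (rule abs_dev_above_le[OF lam_pos unit_lip_integrable[OF assms] rho_integrable])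
      (use unit_lip_diff[OF assms] in auto)
  ultimately show "\<bar>dev_below lam f n\<bar> \<le> dev_below lam \<rho> n" "\<bar>dev_above lam f n\<bar> \<le> dev_above lam \<rho> n"
    by auto
qed

text \<open>The difference is P_f - N_f for f and P - N for \<rho>, and |P_f| + |N_f| \<le> P + N =
  |P - N| + 2 min(P, N). Both versions are kept: the convex case controls P, the concave case
  N.\<close>

lemma gsol_diff_le:
  assumes "unit_lip f"
  defines "P \<equiv> \<lambda>i. (bup lam i - bup lam (Suc i)) * dev_below lam \<rho> (Suc i)"
  defines "N \<equiv> \<lambda>i. (alow lam (Suc i) - alow lam i) * dev_above lam \<rho> (Suc i)"
  shows "\<bar>gsol lam f (Suc (Suc i)) - gsol lam f (Suc i)\<bar> \<le> \<bar>gsol lam \<rho> (Suc (Suc i)) - gsol lam \<rho> (Suc i)\<bar> + 2 * P i"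
    "\<bar>gsol lam f (Suc (Suc i)) - gsol lam f (Suc i)\<bar> \<le> \<bar>gsol lam \<rho> (Suc (Suc i)) - gsol lam \<rho> (Suc i)\<bar> + 2 * N i"
proof -
  have b: "0 \<le> bup lam i - bup lam (Suc i)" using bup_antimono[OF lam_pos] by simp
  have a: "0 \<le> alow lam (Suc i) - alow lam i" using alow_mono[OF lam_pos] by simp
  have "\<bar>(bup lam i - bup lam (Suc i)) * dev_below lam f (Suc i)\<bar> \<le> P i"
    unfolding P_def abs_mult abs_of_nonneg[OF b] by (intro mult_left_mono unit_lip_dev assms b)
  moreover have "\<bar>(alow lam (Suc i) - alow lam i) * dev_above lam f (Suc i)\<bar> \<le> N i"
    unfolding N_def abs_mult abs_of_nonneg[OF a] by (intro mult_left_mono unit_lip_dev assms a)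
  moreover have "gsol lam \<rho> (Suc (Suc i)) - gsol lam \<rho> (Suc i) = P i - N i"
    unfolding gsol_diff[OF lam_pos rho_integrable] P_def N_def by simp
  ultimately show "\<bar>gsol lam f (Suc (Suc i)) - gsol lam f (Suc i)\<bar> \<le> \<bar>gsol lam \<rho> (Suc (Suc i)) - gsol lam \<rho> (Suc i)\<bar> + 2 * P i"
    "\<bar>gsol lam f (Suc (Suc i)) - gsol lam f (Suc i)\<bar> \<le> \<bar>gsol lam \<rho> (Suc (Suc i)) - gsol lam \<rho> (Suc i)\<bar> + 2 * N i"
    unfolding gsol_diff[OF lam_pos unit_lip_integrable[OF assms(1)]] by linarith+
qed

text \<open>The same comparison with three parts: for \<rho> the two outer parts are nonpositive and
  the peak is nonnegative, so only the peak has the exceptional sign and is counted twice.\<close>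

lemma gsol_diff2_le:
  assumes "unit_lip f"
  shows "\<bar>gsol lam f (Suc (Suc (Suc i))) - 2 * gsol lam f (Suc (Suc i)) + gsol lam f (Suc i)\<bar>
    \<le> \<bar>gsol lam \<rho> (Suc (Suc (Suc i))) - 2 * gsol lam \<rho> (Suc (Suc i)) + gsol lam \<rho> (Suc i)\<bar>
      + 2 * kernel_peak lam i * (\<rho> (Suc (Suc i)) - \<rho> (Suc i))"
proof -
  define X where "X = (bup lam i - bup lam (Suc i)) - (bup lam (Suc i) - bup lam (Suc (Suc i)))"
  define Y where "Y = (alow lam (Suc (Suc i)) - alow lam (Suc i)) - (alow lam (Suc i) - alow lam i)"
  have X: "0 \<le> X" using bup_convex[OF lam_pos, of i] by (simp add: X_def)
  have Y: "0 \<le> Y" using alow_convex[OF lam_pos, of i] by (simp add: Y_def)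
  have "\<bar>X * dev_below lam f (Suc i)\<bar> \<le> X * dev_below lam \<rho> (Suc i)"
    unfolding abs_mult abs_of_nonneg[OF X] by (intro mult_left_mono unit_lip_dev assms X)
  moreover have "\<bar>Y * dev_above lam f (Suc (Suc i))\<bar> \<le> Y * dev_above lam \<rho> (Suc (Suc i))"
    unfolding abs_mult abs_of_nonneg[OF Y] by (intro mult_left_mono unit_lip_dev assms Y)
  moreover have "\<bar>kernel_peak lam i * (f (Suc (Suc i)) - f (Suc i))\<bar> \<le> kernel_peak lam i * (\<rho> (Suc (Suc i)) - \<rho> (Suc i))"
    unfolding abs_mult abs_of_nonneg[OF kernel_peak_nonneg[OF lam_pos]] using assms
    by (intro mult_left_mono kernel_peak_nonneg[OF lam_pos]) auto
  ultimately show ?thesis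
    unfolding gsol_diff2[OF lam_pos unit_lip_integrable[OF assms]] gsol_diff2[OF lam_pos rho_integrable]
      X_def[symmetric] Y_def[symmetric] mult_minus_left mult.assoc by linarith
qed

lemma m_rho_ge: "ereal ((\<rho> (Suc i) - \<rho> i) / (\<rho> (Suc (Suc i)) - \<rho> (Suc i))) \<le> m_rho \<rho>"
  unfolding m_rho_def by (rule SUP_upper2[of i]) (auto simp: numeral_eq_Suc)

text \<open>The quantity x is a difference of a Stein solution at k + 1, measured by
  \<Delta>\<rho>(k+1), while L measures y by \<Delta>\<rho>(k), since \<Delta>h(k) is the Stein
  solution at k + 1. The shift by one costs the ratio of consecutive increments, at most
  \<open>m_rho\<close>.\<close>

lemma ratio_le_m_rho_mult:
  assumes x: "x \<le> \<bar>y\<bar> + z * (\<rho> (Suc (Suc k)) - \<rho> (Suc k))"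
    and L: "ereal (\<bar>y\<bar> / (\<rho> (Suc k) - \<rho> k)) \<le> L"
  shows "ereal (x / (\<rho> (Suc (Suc k)) - \<rho> (Suc k))) \<le> m_rho \<rho> * L + ereal z"
proof -
  define d where "d = \<rho> (Suc (Suc k)) - \<rho> (Suc k)"
  define e where "e = \<rho> (Suc k) - \<rho> k"
  have de: "d > 0" "e > 0" using rho_less by (auto simp: d_def e_def)
  have "x / d \<le> (\<bar>y\<bar> + z * d) / d" using x de by (intro divide_right_mono) (auto simp: d_def)
  also have "\<dots> = (e / d) * (\<bar>y\<bar> / e) + z" using de by (simp add: add_divide_distrib)
  finally have "ereal (x / d) \<le> ereal (e / d) * ereal (\<bar>y\<bar> / e) + ereal z" by simp
  also have "\<dots> \<le> m_rho \<rho> * L + ereal z"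
    using m_rho_ge[of k] L de
    by (intro add_right_mono ereal_mult_mono') (auto simp: d_def e_def)
  finally show ?thesis by (simp add: d_def)
qed

text \<open>Eventually constant, and the full increment at \<open>n\<close> makes the Lipschitz norm exactly 1.\<close>

definition truncate_lip :: "(nat \<Rightarrow> real) \<Rightarrow> nat \<Rightarrow> nat \<Rightarrow> real" where
  "truncate_lip f n j = (if j \<le> n then f j else f n + (\<rho> (Suc n) - \<rho> n))"

lemma truncate_lip_unit: "unit_lip f \<Longrightarrow> unit_lip (truncate_lip f n)"
proof
  fix i assume f: "unit_lip f"
  show "\<bar>truncate_lip f n (Suc i) - truncate_lip f n i\<bar> \<le> \<rho> (Suc i) - \<rho> i"
    using f rho_less[of i] by (cases "i < n"; cases "i = n") (auto simp: truncate_lip_def)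
qed

lemma truncate_lip_norm:
  assumes "unit_lip f" shows "lipnorm \<rho> (truncate_lip f n) = 1"
proof (rule antisym)
  show "lipnorm \<rho> (truncate_lip f n) \<le> 1"
    using lipnorm_le_iff[of \<rho> "truncate_lip f n"] rho_less truncate_lip_unit[OF assms] by blast
  show "1 \<le> lipnorm \<rho> (truncate_lip f n)"
    unfolding lipnorm_def
    by (rule SUP_upper2[of n]) (use rho_less[of n] in \<open>auto simp: truncate_lip_def one_ereal_def\<close>)
qed

lemma truncate_lip_pexp:
  assumes f: "unit_lip f"
  shows "(\<lambda>n. pexp lam (truncate_lip f n)) \<longlonglongrightarrow> pexp lam f"
proof -
  \<comment> \<open>One majorant serves all n, since truncation keeps the value at 0 and the
    Lipschitz bound.\<close>
  let ?M = "\<lambda>j. \<bar>\<rho> j + (\<bar>f 0\<bar> - \<rho> 0)\<bar> * pois lam j"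
  have "((\<lambda>n. \<Sum>j. truncate_lip f n j * pois lam j) \<longlonglongrightarrow> (\<Sum>j. f j * pois lam j))"
  proof (rule tannerys_theorem[where M = ?M, THEN conjunct2, THEN conjunct2])
    fix j
    have "eventually (\<lambda>n. f j * pois lam j = truncate_lip f n j * pois lam j) sequentially"
      using eventually_ge_at_top[of j] by eventually_elim (simp add: truncate_lip_def)
    then show "(\<lambda>n. truncate_lip f n j * pois lam j) \<longlonglongrightarrow> f j * pois lam j"
      by (rule Lim_transform_eventually[OF tendsto_const])
  next
    have "norm (truncate_lip f n j * pois lam j) \<le> ?M j" for n j
      using unit_lip_bound[OF truncate_lip_unit[OF f], of n j] pois_gt0[OF lam_pos, of j]
      by (simp add: abs_mult truncate_lip_def mult_right_mono)
    then show "\<forall>\<^sub>F (j, n) in sequentially \<times>\<^sub>F sequentially. norm (truncate_lip f n j * pois lam j) \<le> ?M j"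
      by (intro always_eventually) auto
    have "pois_integrable lam (\<lambda>j. \<rho> j + (\<bar>f 0\<bar> - \<rho> 0))"
      by (intro pois_integrable_add[OF lam_pos] rho_integrable pois_integrable_const[OF lam_pos])
    then show "summable ?M" by (simp add: pois_integrable_def)
  qed simp
  then show ?thesis by (simp add: pexp_def)
qed

lemma truncate_lip_gsol:
  assumes f: "unit_lip f"
  shows "(\<lambda>n. gsol lam (truncate_lip f n) (Suc k)) \<longlonglongrightarrow> gsol lam f (Suc k)"
proof -
  have "(\<lambda>n. (1 / (lam * pois lam k)) * (\<Sum>j<Suc k. pois lam j * (f j - pexp lam (truncate_lip f n)))) \<longlonglongrightarrow> gsol lam f (Suc k)"
    unfolding gsol_Suc[OF lam_pos] by (intro tendsto_intros truncate_lip_pexp f)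
  moreover have "eventually (\<lambda>n. (1 / (lam * pois lam k)) * (\<Sum>j<Suc k. pois lam j * (f j - pexp lam (truncate_lip f n)))
      = gsol lam (truncate_lip f n) (Suc k)) sequentially"
    using eventually_ge_at_top[of k]
  proof eventually_elim
    case (elim n)
    then show ?case unfolding gsol_Suc[OF lam_pos]
      by (intro arg_cong2[where f = "(*)"] refl sum.cong) (auto simp: truncate_lip_def)
  qed
  ultimately show ?thesis by (rule Lim_transform_eventually)
qed

text \<open>For f itself the description in \<open>Qinv\<close> may be empty. Its truncations have
  norm exactly 1, \<open>Qinv_diff\<close> applies to them, and their Stein solutions converge
  pointwise.\<close>

lemma gsol_le_Qinv_norm:
  assumes f: "unit_lip f"
  shows "ereal (\<bar>gsol lam f (Suc k)\<bar> / (\<rho> (Suc k) - \<rho> k)) \<le> Qinv_norm lam \<rho>"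
proof (rule LIMSEQ_le_const2)
  show "(\<lambda>n. ereal (\<bar>gsol lam (truncate_lip f n) (Suc k)\<bar> / (\<rho> (Suc k) - \<rho> k)))
     \<longlonglongrightarrow> ereal (\<bar>gsol lam f (Suc k)\<bar> / (\<rho> (Suc k) - \<rho> k))"
    using rho_less[of k] by (intro tendsto_intros truncate_lip_gsol f) simp
  have "ereal (\<bar>gsol lam (truncate_lip f n) (Suc k)\<bar> / (\<rho> (Suc k) - \<rho> k)) \<le> Qinv_norm lam \<rho>" for n
  proof -
    let ?t = "truncate_lip f n"
    have "Qinv lam ?t (Suc k) - Qinv lam ?t k = - gsol lam ?t (Suc k)"
      by (rule Qinv_diff[OF lam_pos unit_lip_integrable[OF truncate_lip_unit[OF f]], of "Suc n"])
        (simp add: truncate_lip_def)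
    then have "ereal (\<bar>gsol lam ?t (Suc k)\<bar> / (\<rho> (Suc k) - \<rho> k)) \<le> lipnorm \<rho> (Qinv lam ?t)"
      unfolding lipnorm_def by (intro SUP_upper2[of k]) auto
    also have "\<dots> \<le> Qinv_norm lam \<rho>"
      unfolding Qinv_norm_def by (rule SUP_upper) (simp add: truncate_lip_norm[OF f])
    finally show ?thesis .
  qed
  then show "\<exists>N. \<forall>n\<ge>N. ereal (\<bar>gsol lam (truncate_lip f n) (Suc k)\<bar> / (\<rho> (Suc k) - \<rho> k)) \<le> Qinv_norm lam \<rho>"
    by blast
qed

section \<open>The bounds for M_0, M_1 and M_2\<close>

lemma Mk_SUP_le:
  assumes "\<And>f k. unit_lip f \<Longrightarrow> ereal (\<bar>fdiff q (gsol lam f) (Suc k)\<bar> / (\<rho> (Suc (Suc k)) - \<rho> (Suc k))) \<le> B"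
  shows "(SUP f\<in>{f. lipnorm \<rho> f = 1}. Mk \<rho> q (gsol lam f)) \<le> B"
proof (rule SUP_least)
  fix f assume "f \<in> {f. lipnorm \<rho> f = 1}"
  then have f: "unit_lip f" using lipnorm_1_imp by blast
  show "Mk \<rho> q (gsol lam f) \<le> B"
    unfolding Mk_def
  proof (rule SUP_least)
    fix i :: nat assume "i \<in> {1..}"
    then obtain k where "i = Suc k" by (cases i) auto
    then show "ereal (\<bar>fdiff q (gsol lam f) i\<bar> / fdiff 1 \<rho> i) \<le> B" using assms[OF f, of k] by simp
  qed
qed

lemma M0_bound: "(SUP f\<in>{f. lipnorm \<rho> f = 1}. Mk \<rho> 0 (gsol lam f)) \<le> m_rho \<rho> * Qinv_norm lam \<rho>"
proof (rule Mk_SUP_le)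
  fix f k assume "unit_lip f"
  from ratio_le_m_rho_mult[OF _ gsol_le_Qinv_norm[OF this, of k], of "\<bar>gsol lam f (Suc k)\<bar>" 0]
  show "ereal (\<bar>fdiff 0 (gsol lam f) (Suc k)\<bar> / (\<rho> (Suc (Suc k)) - \<rho> (Suc k))) \<le> m_rho \<rho> * Qinv_norm lam \<rho>"
    by simp
qed

context
  fixes h :: "nat \<Rightarrow> real"
  assumes h_sol: "\<forall>i. Qgen lam h i = \<rho> i - pexp lam \<rho>"
begin

lemma h_diff: "h (Suc i) - h i = gsol lam \<rho> (Suc i)"
  by (rule Qgen_eq_imp_diff[OF lam_pos h_sol])

lemma lipnorm_fdiff_h_ge: "ereal (\<bar>fdiff (Suc q) h (Suc k) - fdiff (Suc q) h k\<bar> / (\<rho> (Suc k) - \<rho> k)) \<le> lipnorm \<rho> (fdiff (Suc q) h)"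
  unfolding lipnorm_def by (rule SUP_upper) simp

lemma M2_bound:
  "(SUP f\<in>{f. lipnorm \<rho> f = 1}. Mk \<rho> 2 (gsol lam f))
    \<le> m_rho \<rho> * lipnorm \<rho> (fdiff 2 h) + ereal (2 * min (2 * Xi2 lam) (1 / lam))"
proof (rule Mk_SUP_le)
  fix f k assume f: "unit_lip f"
  \<comment> \<open>By \<open>h_diff\<close> the increment of \<Delta>^2 h at k is the second
    difference of the Stein solution of \<rho> at k + 1.\<close>
  define y where "y = fdiff 2 h (Suc k) - fdiff 2 h k"
  have y: "y = gsol lam \<rho> (Suc (Suc (Suc k))) - 2 * gsol lam \<rho> (Suc (Suc k)) + gsol lam \<rho> (Suc k)"
    unfolding y_def by (simp add: numeral_2_eq_2 h_diff)
  have "fdiff 2 (gsol lam f) (Suc k) = gsol lam f (Suc (Suc (Suc k))) - 2 * gsol lam f (Suc (Suc k)) + gsol lam f (Suc k)"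
    by (simp add: numeral_2_eq_2)
  with gsol_diff2_le[OF f, of k]
  have "\<bar>fdiff 2 (gsol lam f) (Suc k)\<bar> \<le> \<bar>y\<bar> + 2 * kernel_peak lam k * (\<rho> (Suc (Suc k)) - \<rho> (Suc k))"
    by (simp add: y)
  also have "\<dots> \<le> \<bar>y\<bar> + 2 * min (2 * Xi2 lam) (1 / lam) * (\<rho> (Suc (Suc k)) - \<rho> (Suc k))"
    using kernel_peak_le[OF lam_pos, of k] kernel_peak_le_Xi2[OF lam_pos, of k] rho_less[of "Suc k"]
    by (intro add_left_mono mult_right_mono) auto
  finally show "ereal (\<bar>fdiff 2 (gsol lam f) (Suc k)\<bar> / (\<rho> (Suc (Suc k)) - \<rho> (Suc k)))
      \<le> m_rho \<rho> * lipnorm \<rho> (fdiff 2 h) + ereal (2 * min (2 * Xi2 lam) (1 / lam))"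
    by (rule ratio_le_m_rho_mult) (use lipnorm_fdiff_h_ge[of 1 k] in \<open>simp add: y_def numeral_2_eq_2\<close>)
qed

lemma fdiff_1_gsol:
  "fdiff 1 (gsol lam f) (Suc k) = gsol lam f (Suc (Suc k)) - gsol lam f (Suc k)"
  "fdiff 1 h (Suc k) - fdiff 1 h k = gsol lam \<rho> (Suc (Suc k)) - gsol lam \<rho> (Suc k)"
  by (simp_all add: h_diff)

text \<open>Increments of a convex \<rho> below k + 1 are at most e = \<Delta>\<rho>(k), so the
  lower part is at most e times \<open>kernel_mass\<close>. Dividing by d = \<Delta>\<rho>(k+1)
  leaves the ratio e/d, whence the second \<open>m_rho\<close>.\<close>

lemma M1_bound_convex:
  assumes conv: "\<forall>i. fdiff 2 \<rho> i \<ge> 0"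
  shows "(SUP f\<in>{f. lipnorm \<rho> f = 1}. Mk \<rho> 1 (gsol lam f))
      \<le> m_rho \<rho> * lipnorm \<rho> (fdiff 1 h) + 2 * m_rho \<rho> * ereal (Xi1 lam)"
proof (rule Mk_SUP_le)
  fix f k assume f: "unit_lip f"
  define d where "d = \<rho> (Suc (Suc k)) - \<rho> (Suc k)"
  define e where "e = \<rho> (Suc k) - \<rho> k"
  have de: "d > 0" "e > 0" using rho_less by (auto simp: d_def e_def)
  have inc: "incseq (\<lambda>i. \<rho> (Suc i) - \<rho> i)"
  proof (rule incseq_SucI)
    show "\<rho> (Suc n) - \<rho> n \<le> \<rho> (Suc (Suc n)) - \<rho> (Suc n)" for n
      using conv[rule_format, of n] by (simp add: numeral_2_eq_2)
  qed
  have "\<rho> (Suc k) - \<rho> j \<le> e * (real (Suc k) - real j)" if "j < Suc k" for j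
  proof -
    have "j \<le> Suc k" using that by simp
    then show ?thesis
    proof (induction j rule: inc_induct)
      case (step n)
      have "\<rho> (Suc n) - \<rho> n \<le> e" using incseqD[OF inc, of n k] step by (simp add: e_def)
      then show ?case using step by (simp add: algebra_simps)
    qed simp
  qed
  then have "\<bar>dev_below lam \<rho> (Suc k)\<bar> \<le> e * dev_below lam real (Suc k)"
    by (intro abs_dev_below_le[OF lam_pos]) (auto simp: rho_mono)
  then have "(bup lam k - bup lam (Suc k)) * dev_below lam \<rho> (Suc k) \<le> (bup lam k - bup lam (Suc k)) * (e * dev_below lam real (Suc k))"
    using bup_antimono[OF lam_pos, of k] by (intro mult_left_mono) auto
  also have "\<dots> = e * kernel_mass lam k" by (simp add: kernel_mass_def[OF lam_pos])
  also have "\<dots> \<le> e * Xi1 lam" using kernel_mass_le[OF lam_pos, of k] de by simp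
  finally have "\<bar>fdiff 1 (gsol lam f) (Suc k)\<bar> \<le> \<bar>fdiff 1 h (Suc k) - fdiff 1 h k\<bar> + (2 * (e / d) * Xi1 lam) * d"
    unfolding fdiff_1_gsol using gsol_diff_le(1)[OF f, of k] de by simp
  then have "ereal (\<bar>fdiff 1 (gsol lam f) (Suc k)\<bar> / (\<rho> (Suc (Suc k)) - \<rho> (Suc k)))
      \<le> m_rho \<rho> * lipnorm \<rho> (fdiff 1 h) + ereal (2 * (e / d) * Xi1 lam)"
    unfolding d_def by (rule ratio_le_m_rho_mult) (use lipnorm_fdiff_h_ge[of 0 k] in simp)
  also have "\<dots> \<le> m_rho \<rho> * lipnorm \<rho> (fdiff 1 h) + 2 * m_rho \<rho> * ereal (Xi1 lam)"
  proof (rule add_left_mono)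
    \<comment> \<open>Multiplying the bound for e/d by \<open>Xi1\<close> requires
      \<open>Xi1\<close> to be nonnegative; this follows from the sign of the mass.\<close>
    have "0 \<le> kernel_mass lam k"
      unfolding kernel_mass_def[OF lam_pos]
      using bup_antimono[OF lam_pos, of k] abs_dev_below_le[OF lam_pos, of "Suc k" real 1 real] by simp
    then have "0 \<le> Xi1 lam" using kernel_mass_le[OF lam_pos, of k] by linarith
    moreover have "ereal (e / d) \<le> m_rho \<rho>" using m_rho_ge[of k] by (simp add: d_def e_def)
    ultimately have "2 * ereal (e / d) * ereal (Xi1 lam) \<le> 2 * m_rho \<rho> * ereal (Xi1 lam)"
      by (intro ereal_mult_right_mono ereal_mult_left_mono) auto
    then show "ereal (2 * (e / d) * Xi1 lam) \<le> 2 * m_rho \<rho> * ereal (Xi1 lam)"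
      by (simp add: numeral_eq_ereal)
  qed
  finally show "ereal (\<bar>fdiff 1 (gsol lam f) (Suc k)\<bar> / (\<rho> (Suc (Suc k)) - \<rho> (Suc k)))
      \<le> m_rho \<rho> * lipnorm \<rho> (fdiff 1 h) + 2 * m_rho \<rho> * ereal (Xi1 lam)" .
qed

text \<open>For concave \<rho> the increments from k + 1 on are at most d = \<Delta>\<rho>(k+1), the
  denominator itself; so the upper part is used and the second term acquires no ratio.\<close>

lemma M1_bound_concave:
  assumes conc: "\<forall>i. fdiff 2 \<rho> i \<le> 0"
  shows "(SUP f\<in>{f. lipnorm \<rho> f = 1}. Mk \<rho> 1 (gsol lam f))
      \<le> m_rho \<rho> * lipnorm \<rho> (fdiff 1 h) + ereal (2 * Xi1 lam)"
proof (rule Mk_SUP_le)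
  fix f k assume f: "unit_lip f"
  define d where "d = \<rho> (Suc (Suc k)) - \<rho> (Suc k)"
  have d: "d > 0" using rho_less by (auto simp: d_def)
  have dec: "decseq (\<lambda>i. \<rho> (Suc i) - \<rho> i)"
  proof (rule decseq_SucI)
    show "\<rho> (Suc (Suc n)) - \<rho> (Suc n) \<le> \<rho> (Suc n) - \<rho> n" for n
      using conc[rule_format, of n] by (simp add: numeral_2_eq_2)
  qed
  have "\<rho> j - \<rho> (Suc k) \<le> d * (real j - real (Suc k))" if "Suc k \<le> j" for j
    using that
  proof (induction j rule: dec_induct)
    case (step n)
    have "\<rho> (Suc n) - \<rho> n \<le> d" using decseqD[OF dec, of "Suc k" n] step by (simp add: d_def)
    then show ?case using step by (simp add: algebra_simps)
  qed simp
  then have "\<bar>dev_above lam \<rho> (Suc k)\<bar> \<le> d * dev_above lam real (Suc k)"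
    by (intro abs_dev_above_le[OF lam_pos rho_integrable pois_integrable_real[OF lam_pos]]) (auto simp: rho_mono)
  then have "(alow lam (Suc k) - alow lam k) * dev_above lam \<rho> (Suc k) \<le> (alow lam (Suc k) - alow lam k) * (d * dev_above lam real (Suc k))"
    using alow_mono[OF lam_pos, of k] by (intro mult_left_mono) auto
  also have "\<dots> = d * kernel_mass lam k" by (simp add: kernel_mass_eq[OF lam_pos])
  also have "\<dots> \<le> d * Xi1 lam" using kernel_mass_le[OF lam_pos, of k] d by simp
  finally have "\<bar>fdiff 1 (gsol lam f) (Suc k)\<bar> \<le> \<bar>fdiff 1 h (Suc k) - fdiff 1 h k\<bar> + (2 * Xi1 lam) * d"
    unfolding fdiff_1_gsol using gsol_diff_le(2)[OF f, of k] by (simp add: mult.commute)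
  then show "ereal (\<bar>fdiff 1 (gsol lam f) (Suc k)\<bar> / (\<rho> (Suc (Suc k)) - \<rho> (Suc k)))
      \<le> m_rho \<rho> * lipnorm \<rho> (fdiff 1 h) + ereal (2 * Xi1 lam)"
    unfolding d_def by (rule ratio_le_m_rho_mult) (use lipnorm_fdiff_h_ge[of 0 k] in simp)
qed

end

end

theorem theorem1p1:
  fixes lam :: real and \<rho> h :: "nat \<Rightarrow> real"
  assumes lam_pos: "lam > 0"
    and rhoA: "classA lam \<rho>"
    and h_sol: "\<forall>i. Qgen lam h i = \<rho> i - pexp lam \<rho>"
  shows
    "(SUP f\<in>{f. lipnorm \<rho> f = 1}. Mk \<rho> 0 (gsol lam f)) \<le> m_rho \<rho> * Qinv_norm lam \<rho>
   \<and> (SUP f\<in>{f. lipnorm \<rho> f = 1}. Mk \<rho> 2 (gsol lam f))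
        \<le> m_rho \<rho> * lipnorm \<rho> (fdiff 2 h) + ereal (2 * min (2 * Xi2 lam) (1 / lam))
   \<and> (lam \<le> 1 \<longrightarrow> Xi2 lam \<le> 1 / 3)
   \<and> (lam > 1 \<longrightarrow> Xi2 lam \<le> 0.426 / sqrt lam)
   \<and> ((\<forall>i. fdiff 2 \<rho> i \<ge> 0) \<longrightarrow>
        (SUP f\<in>{f. lipnorm \<rho> f = 1}. Mk \<rho> 1 (gsol lam f))
          \<le> m_rho \<rho> * lipnorm \<rho> (fdiff 1 h) + 2 * m_rho \<rho> * ereal (Xi1 lam))
   \<and> ((\<forall>i. fdiff 2 \<rho> i \<le> 0) \<longrightarrow>
        (SUP f\<in>{f. lipnorm \<rho> f = 1}. Mk \<rho> 1 (gsol lam f))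
          \<le> m_rho \<rho> * lipnorm \<rho> (fdiff 1 h) + ereal (2 * Xi1 lam))
   \<and> (lam \<le> 1 \<longrightarrow> Xi1 lam \<le> 1 / 2)
   \<and> (lam > 1 \<longrightarrow> Xi1 lam \<le> 0.532 / sqrt lam)"
proof -
  interpret stein_weight lam \<rho> using lam_pos rhoA by unfold_locales
  show ?thesis
    using M0_bound M2_bound[OF h_sol] M1_bound_convex[OF h_sol] M1_bound_concave[OF h_sol]
      Xi1_le_small[OF lam_pos] Xi2_le_small[OF lam_pos] Xi1_le_large Xi2_le_large by blast
qed

end
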